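(* Let $h\in\mathbb{R}\setminus\{0\}$ be an arbitrary constant. Let $X$ be a compact complex manifold with $\dim_{\mathbb{C}}X=n$. Fix an arbitrary $k\in\{0,\dots,2n\}$ and suppose that for every $k$-form $u\in\ker d_h\cap\ker d_{-h^{-1}}$ the following exactness conditions are equivalent: $$u\in\mathrm{Im}\,d_h\iff u\in\mathrm{Im}\,d_{-h^{-1}}\iff u\in\mathrm{Im}\,(d_h\,d_{-h^{-1}})=\mathrm{Im}\,(\partial\bar\partial).$$ Then, for every $k$-form $u\in\ker d_h\cap\ker d_{-h^{-1}}$, the equivalence $$u\in\mathrm{Im}\,d\iff u\in\mathrm{Im}\,(d_h\,d_{-h^{-1}})=\mathrm{Im}\,(\partial\bar\partial)$$ also holds. In particular, if the assumption is made for all $k\in\{0,\dots,2n\}$, then $X$ is an $h$-$\partial\bar\partial$-manifold.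
   Context: Forms are smooth and $\mathbb{C}$-valued, not necessarily of pure type; $d_h:=h\partial+\bar\partial$, so $d_{-h^{-1}}=-h^{-1}\partial+\bar\partial$. A compact complex manifold $X$ with $\dim_{\mathbb{C}}X=n$ is an $h$-$\partial\bar\partial$-manifold if for every $k\in\{0,1,\dots,2n\}$ and every $k$-form $u\in\ker d_h\cap\ker d_{-h^{-1}}$ one has $$u\in\mathrm{Im}\,d_h\iff u\in\mathrm{Im}\,d_{-h^{-1}}\iff u\in\mathrm{Im}\,d\iff u\in\mathrm{Im}\,(d_h\,d_{-h^{-1}})=\mathrm{Im}\,(\partial\bar\partial).$$ *)

theory Defs
  imports "HOL-Analysis.Analysis"
begin

section \<open>Smooth and holomorphic maps\<close>

text \<open>Derivatives are unrestricted, so this is the usual notion for open \<open>S\<close> only.\<close>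

primrec Ck_on :: "nat \<Rightarrow> 'e::real_normed_vector set \<Rightarrow> ('e \<Rightarrow> 'f::real_normed_vector) \<Rightarrow> bool" where
  "Ck_on 0 S f \<longleftrightarrow> continuous_on S f"
| "Ck_on (Suc k) S f \<longleftrightarrow>
     (\<forall>x\<in>S. f differentiable at x) \<and> (\<forall>v. Ck_on k S (\<lambda>x. frechet_derivative f (at x) v))"

definition smooth_on :: "'e::real_normed_vector set \<Rightarrow> ('e \<Rightarrow> 'f::real_normed_vector) \<Rightarrow> bool" where
  "smooth_on S f \<longleftrightarrow> (\<forall>k. Ck_on k S f)"

text \<open>The Wirtinger derivatives \<open>\<partial>f/\<partial>z\<^sub>j = (\<partial>f/\<partial>x\<^sub>j - \<i> \<partial>f/\<partial>y\<^sub>j)/2\<close> and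
  \<open>\<partial>f/\<partial>zbar\<^sub>j = (\<partial>f/\<partial>x\<^sub>j + \<i> \<partial>f/\<partial>y\<^sub>j)/2\<close>.\<close>

definition partial_z :: "'n::finite \<Rightarrow> (complex^'n \<Rightarrow> complex) \<Rightarrow> complex^'n \<Rightarrow> complex" where
  "partial_z j f x =
     (frechet_derivative f (at x) (axis j 1) - \<i> * frechet_derivative f (at x) (axis j \<i>)) / 2"

definition partial_zbar :: "'n::finite \<Rightarrow> (complex^'n \<Rightarrow> complex) \<Rightarrow> complex^'n \<Rightarrow> complex" where
  "partial_zbar j f x =
     (frechet_derivative f (at x) (axis j 1) + \<i> * frechet_derivative f (at x) (axis j \<i>)) / 2"

text \<open>Holomorphy in several variables: smooth and annihilated by \<open>\<partial>/\<partial>zbar\<^sub>j\<close> for all \<open>j\<close>.\<close>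

definition holomorphic_map_on :: "(complex^'n::finite) set \<Rightarrow> (complex^'n \<Rightarrow> complex^'m::finite) \<Rightarrow> bool" where
  "holomorphic_map_on S F \<longleftrightarrow>
     smooth_on S F \<and> (\<forall>x\<in>S. \<forall>i j. partial_zbar j (\<lambda>y. F y $ i) x = 0)"


section \<open>Complex manifolds\<close>

text \<open>A chart is a pair of its domain and its coordinate map; the coordinate map is relevant on
  the domain only. The complex dimension is the cardinality of the index type \<open>'n\<close>.\<close>

type_synonym ('a, 'n) chart = "'a set \<times> ('a \<Rightarrow> complex^'n)"

definition chart_image :: "('a, 'n::finite) chart \<Rightarrow> (complex^'n) set" where
  "chart_image c = snd c ` fst c"

definition is_chart :: "'a topology \<Rightarrow> ('a, 'n::finite) chart \<Rightarrow> bool" where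
  "is_chart X c \<longleftrightarrow> openin X (fst c) \<and> open (chart_image c) \<and>
     homeomorphic_map (subtopology X (fst c)) (top_of_set (chart_image c)) (snd c)"

definition overlap :: "('a, 'n::finite) chart \<Rightarrow> ('a, 'n) chart \<Rightarrow> (complex^'n) set" where
  "overlap c c' = snd c ` (fst c \<inter> fst c')"

definition transition :: "('a, 'n::finite) chart \<Rightarrow> ('a, 'n) chart \<Rightarrow> complex^'n \<Rightarrow> complex^'n" where
  "transition c c' = snd c' \<circ> inv_into (fst c) (snd c)"

definition complex_manifold :: "'a topology \<Rightarrow> ('a, 'n::finite) chart set \<Rightarrow> bool" where
  "complex_manifold X A \<longleftrightarrow>
     Hausdorff_space X \<and> second_countable X \<and>
     (\<forall>c\<in>A. is_chart X c) \<and> (\<Union>c\<in>A. fst c) = topspace X \<and>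
     (\<forall>c\<in>A. \<forall>c'\<in>A. holomorphic_map_on (overlap c c') (transition c c'))"

definition compact_complex_manifold :: "'a topology \<Rightarrow> ('a, 'n::finite) chart set \<Rightarrow> bool" where
  "compact_complex_manifold X A \<longleftrightarrow> complex_manifold X A \<and> compact_space X"


section \<open>Complex-valued differential forms\<close>

text \<open>A form is given by its coordinate expressions: \<open>u c x [v\<^sub>1,\<dots>,v\<^sub>k]\<close> is the value, on real tangent
  vectors \<open>v\<^sub>1,\<dots>,v\<^sub>k\<close>, of the expression of \<open>u\<close> in the chart \<open>c\<close> at the point with coordinates \<open>x\<close>.\<close>

type_synonym ('a, 'n) form = "('a, 'n) chart \<Rightarrow> complex^'n \<Rightarrow> (complex^'n) list \<Rightarrow> complex"

definition alternating_form :: "int \<Rightarrow> ((complex^'n::finite) list \<Rightarrow> complex) \<Rightarrow> bool" where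
  "alternating_form k \<eta> \<longleftrightarrow>
     (\<forall>vs. int (length vs) \<noteq> k \<longrightarrow> \<eta> vs = 0) \<and>
     (\<forall>vs i. int (length vs) = k \<longrightarrow> i < length vs \<longrightarrow> linear (\<lambda>v. \<eta> (vs[i := v]))) \<and>
     (\<forall>vs. int (length vs) = k \<longrightarrow> \<not> distinct vs \<longrightarrow> \<eta> vs = 0)"

text \<open>Smooth \<open>k\<close>-forms on the manifold with atlas \<open>A\<close>: smooth local expressions that are related by
  pullback along the transition maps. The degree is an integer so that in negative degree the
  zero form is the only form. Values outside the relevant range are normalised to \<open>0\<close>, hence
  equality of forms is equality of functions.\<close>

definition forms :: "('a, 'n::finite) chart set \<Rightarrow> int \<Rightarrow> ('a, 'n) form set" where
  "forms A k = {u.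
     (\<forall>c x vs. c \<notin> A \<or> x \<notin> chart_image c \<longrightarrow> u c x vs = 0) \<and>
     (\<forall>c\<in>A. \<forall>x\<in>chart_image c. alternating_form k (u c x)) \<and>
     (\<forall>c\<in>A. \<forall>vs. smooth_on (chart_image c) (\<lambda>x. u c x vs)) \<and>
     (\<forall>c\<in>A. \<forall>c'\<in>A. \<forall>x\<in>overlap c c'. \<forall>vs.
        u c x vs =
        u c' (transition c c' x) (map (frechet_derivative (transition c c') (at x)) vs))}"

definition delete_nth :: "nat \<Rightarrow> 'b list \<Rightarrow> 'b list" where
  "delete_nth i vs = take i vs @ drop (Suc i) vs"

text \<open>The exterior derivative
  \<open>(du)(v\<^sub>0,\<dots>,v\<^sub>k) = \<Sum>\<^sub>i (-1)\<^sup>i D(u(v\<^sub>0,\<dots>,v\<^sub>i\<^sub>-\<^sub>1,v\<^sub>i\<^sub>+\<^sub>1,\<dots>,v\<^sub>k))(v\<^sub>i)\<close>, for constant vector fields \<open>v\<^sub>i\<close>.\<close>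

definition ext_d :: "('a, 'n::finite) form \<Rightarrow> ('a, 'n) form" where
  "ext_d u c x vs =
     (if x \<in> chart_image c
      then \<Sum>i<length vs. (-1)^i * frechet_derivative (\<lambda>y. u c y (delete_nth i vs)) (at x) (vs ! i)
      else 0)"

text \<open>The exterior product \<open>\<alpha> \<and> \<eta>\<close> of a 1-form \<open>\<alpha>\<close> and an alternating form \<open>\<eta>\<close>.\<close>

definition wedge1 :: "('e \<Rightarrow> complex) \<Rightarrow> ('e list \<Rightarrow> complex) \<Rightarrow> 'e list \<Rightarrow> complex" where
  "wedge1 \<alpha> \<eta> vs = (\<Sum>i<length vs. (-1)^i * \<alpha> (vs ! i) * \<eta> (delete_nth i vs))"

text \<open>\<open>\<partial>u = \<Sum>\<^sub>j dz\<^sub>j \<and> \<partial>u/\<partial>z\<^sub>j\<close> and \<open>\<partial>bar u = \<Sum>\<^sub>j dzbar\<^sub>j \<and> \<partial>u/\<partial>zbar\<^sub>j\<close>, where the coefficients of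
  \<open>u\<close> are differentiated.\<close>

definition del_op :: "('a, 'n::finite) form \<Rightarrow> ('a, 'n) form" where
  "del_op u c x vs =
     (if x \<in> chart_image c
      then \<Sum>j\<in>UNIV. wedge1 (\<lambda>v. v $ j) (\<lambda>ws. partial_z j (\<lambda>y. u c y ws) x) vs
      else 0)"

definition delbar_op :: "('a, 'n::finite) form \<Rightarrow> ('a, 'n) form" where
  "delbar_op u c x vs =
     (if x \<in> chart_image c
      then \<Sum>j\<in>UNIV. wedge1 (\<lambda>v. cnj (v $ j)) (\<lambda>ws. partial_zbar j (\<lambda>y. u c y ws) x) vs
      else 0)"

definition d_h :: "real \<Rightarrow> ('a, 'n::finite) form \<Rightarrow> ('a, 'n) form" where
  "d_h h u c x vs = of_real h * del_op u c x vs + delbar_op u c x vs"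


section \<open>Kernels, images and \<open>h\<close>-\<open>\<partial>\<partial>bar\<close>-manifolds\<close>

definition ker_h :: "('a, 'n::finite) chart set \<Rightarrow> real \<Rightarrow> int \<Rightarrow> ('a, 'n) form set" where
  "ker_h A h k = {u \<in> forms A k. d_h h u = (\<lambda>c x vs. 0)}"

text \<open>Images are taken among forms of degree \<open>k\<close>; in degree \<open>0\<close> (and, for the second order operators, in
  degree \<open>1\<close>) they consist of the zero form only.\<close>

definition im_d :: "('a, 'n::finite) chart set \<Rightarrow> int \<Rightarrow> ('a, 'n) form set" where
  "im_d A k = ext_d ` forms A (k - 1)"

definition im_h :: "('a, 'n::finite) chart set \<Rightarrow> real \<Rightarrow> int \<Rightarrow> ('a, 'n) form set" where
  "im_h A h k = d_h h ` forms A (k - 1)"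

definition im_hh :: "('a, 'n::finite) chart set \<Rightarrow> real \<Rightarrow> real \<Rightarrow> int \<Rightarrow> ('a, 'n) form set" where
  "im_hh A h h' k = (d_h h \<circ> d_h h') ` forms A (k - 2)"

definition im_del_delbar :: "('a, 'n::finite) chart set \<Rightarrow> int \<Rightarrow> ('a, 'n) form set" where
  "im_del_delbar A k = (del_op \<circ> delbar_op) ` forms A (k - 2)"

definition h_del_delbar_manifold ::
    "real \<Rightarrow> 'a topology \<Rightarrow> ('a, 'n::finite) chart set \<Rightarrow> bool" where
  "h_del_delbar_manifold h X A \<longleftrightarrow>
     compact_complex_manifold X A \<and>
     (\<forall>k\<in>{0..2 * int CARD('n)}. \<forall>u \<in> ker_h A h k \<inter> ker_h A (- (1/h)) k.
        (u \<in> im_h A h k \<longleftrightarrow> u \<in> im_h A (- (1/h)) k) \<and>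
        (u \<in> im_h A (- (1/h)) k \<longleftrightarrow> u \<in> im_d A k) \<and>
        (u \<in> im_d A k \<longleftrightarrow> u \<in> im_hh A h (- (1/h)) k)) \<and>
     (\<forall>k\<in>{0..2 * int CARD('n)}. im_hh A h (- (1/h)) k = im_del_delbar A k)"

end

theory Submission
  imports Defs
begin

text \<open>For \<open>h \<noteq> 0\<close> let \<open>\<theta>\<^sub>h\<close> multiply the component of type \<open>(p,q)\<close> of a form by \<open>h\<^sup>p\<close>. It is invertible
  with inverse \<open>\<theta>\<^sub>1\<^sub>/\<^sub>h\<close>, and \<open>\<theta>\<^sub>h \<partial> = h \<partial> \<theta>\<^sub>h\<close> and \<open>\<theta>\<^sub>h \<partial>bar = \<partial>bar \<theta>\<^sub>h\<close>, so \<open>\<theta>\<^sub>h d = d\<^sub>h \<theta>\<^sub>h\<close>. Therefore \<open>\<theta>\<^sub>h\<close>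
  carries the image of \<open>d\<close> onto the image of \<open>d\<^sub>h\<close> and maps \<open>ker \<partial>\<close>, \<open>ker \<partial>bar\<close> and the image of \<open>\<partial>\<partial>bar\<close>
  onto themselves. Since \<open>h\<close> and \<open>-1/h\<close> differ, the common kernel of \<open>d\<^sub>h\<close> and \<open>d\<^sub>-\<^sub>1\<^sub>/\<^sub>h\<close> is
  \<open>ker \<partial> \<inter> ker \<partial>bar\<close>, and \<open>d\<^sub>h d\<^sub>-\<^sub>1\<^sub>/\<^sub>h = (h + 1/h) \<partial>\<partial>bar\<close> has the same image as \<open>\<partial>\<partial>bar\<close>. For \<open>u\<close> in the
  common kernel this gives
  \<open>u \<in> Im d \<longleftrightarrow> \<theta>\<^sub>h u \<in> Im d\<^sub>h \<longleftrightarrow> \<theta>\<^sub>h u \<in> Im \<partial>\<partial>bar \<longleftrightarrow> u \<in> Im \<partial>\<partial>bar\<close>, where the middle equivalence is the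
  assumed one for the form \<open>\<theta>\<^sub>h u\<close>, which is again in the common kernel.

  Three facts carry this. The form \<open>\<theta>\<^sub>h u\<close> is the pullback of \<open>u\<close> along an endomorphism \<open>T\<close> of the
  complexified tangent spaces (\<open>type_scale\<close>), so that its compatibility with holomorphic changes of
  charts amounts to the complex linearity of their derivatives (\<open>scale_form_forms\<close>). The commutation
  with \<open>\<partial>\<close> and \<open>\<partial>bar\<close> holds because \<open>T\<close> has constant coefficients in coordinates and pulls \<open>dz\<^sub>j\<close> back
  to \<open>h dz\<^sub>j\<close> and \<open>dzbar\<^sub>j\<close> to itself (\<open>scale_form_type_op\<close>). The relations \<open>\<partial>\<^sup>2 = 0\<close>, \<open>\<partial>bar\<^sup>2 = 0\<close> and
  \<open>\<partial>\<partial>bar = - \<partial>bar\<partial>\<close> rest on the symmetry of second derivatives (\<open>type_op_anticommute\<close>).\<close>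

section \<open>Smooth complex-valued functions\<close>

lemma has_derivative_complex_lincomb:
  fixes f g :: "'e::real_normed_vector \<Rightarrow> complex"
  assumes "(f has_derivative F) (at x)" "(g has_derivative G) (at x)"
  shows "((\<lambda>y. a * f y + b * g y) has_derivative (\<lambda>v. a * F v + b * G v)) (at x)"
  using assms by (intro has_derivative_add has_derivative_mult_right)

lemma frechet_derivative_lincomb:
  fixes f g :: "'e::real_normed_vector \<Rightarrow> complex"
  assumes "f differentiable at x" "g differentiable at x"
  shows "frechet_derivative (\<lambda>y. a * f y + b * g y) (at x) v =
    a * frechet_derivative f (at x) v + b * frechet_derivative g (at x) v"
  using frechet_derivative_at[OF has_derivative_complex_lincomb, of f _ x g _ a b] assms
  by (metis frechet_derivative_works)

lemma differentiable_lincomb: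
  fixes f g :: "'e::real_normed_vector \<Rightarrow> complex"
  assumes "f differentiable at x" "g differentiable at x"
  shows "(\<lambda>y. a * f y + b * g y) differentiable at x"
  using assms has_derivative_complex_lincomb unfolding differentiable_def by blast

lemma Ck_on_cong:
  assumes "open S" "\<And>x. x \<in> S \<Longrightarrow> f x = g x"
  shows "Ck_on k S f \<longleftrightarrow> Ck_on k S g"
proof -
  have imp: "Ck_on k S g" if "Ck_on k S f" "\<And>x. x \<in> S \<Longrightarrow> f x = g x" for f g :: "'a \<Rightarrow> 'b"
    using that
  proof (induction k arbitrary: f g)
    case 0
    then show ?case using continuous_on_cong[of S S f g] by auto
  next
    case (Suc k)
    have eq: "frechet_derivative f (at x) = frechet_derivative g (at x)" if "x \<in> S" for x
      by (rule frechet_derivative_transform_within_open) (use Suc.prems assms(1) that in auto)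
    have "g differentiable at x" if "x \<in> S" for x
      using Suc.prems assms(1) that unfolding differentiable_def Ck_on.simps
      by (metis has_derivative_transform_within_open)
    moreover have "Ck_on k S (\<lambda>x. frechet_derivative g (at x) v)" for v
      by (rule Suc.IH[of "\<lambda>x. frechet_derivative f (at x) v"]) (use Suc.prems eq in auto)
    ultimately show ?case by simp
  qed
  show ?thesis using imp[of f g] imp[of g f] assms(2) by metis
qed

lemma smooth_on_cong:
  assumes "open S" "\<And>x. x \<in> S \<Longrightarrow> f x = g x"
  shows "smooth_on S f \<longleftrightarrow> smooth_on S g"
  using Ck_on_cong[OF assms] by (simp add: smooth_on_def)

lemma smooth_on_differentiable:
  assumes "smooth_on S f" "x \<in> S"
  shows "f differentiable at x"
  using assms unfolding smooth_on_def by (metis Ck_on.simps(2))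

lemma smooth_on_frechet_derivative:
  assumes "smooth_on S f"
  shows "smooth_on S (\<lambda>x. frechet_derivative f (at x) v)"
  using assms unfolding smooth_on_def by (metis Ck_on.simps(2))

lemma Ck_on_lincomb:
  fixes f g :: "'e::real_normed_vector \<Rightarrow> complex"
  assumes "open S" "Ck_on k S f" "Ck_on k S g"
  shows "Ck_on k S (\<lambda>x. a * f x + b * g x)"
  using assms(2,3)
proof (induction k arbitrary: f g)
  case 0
  then show ?case by (auto intro!: continuous_intros)
next
  case (Suc k)
  have "Ck_on k S (\<lambda>x. frechet_derivative (\<lambda>x. a * f x + b * g x) (at x) v)" for v
  proof -
    have "Ck_on k S (\<lambda>x. a * frechet_derivative f (at x) v + b * frechet_derivative g (at x) v)"
      using Suc by auto
    then show ?thesis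
      by (subst Ck_on_cong[OF assms(1)]) (use Suc.prems in \<open>auto simp: frechet_derivative_lincomb\<close>)
  qed
  then show ?case using Suc.prems by (auto intro: differentiable_lincomb)
qed

lemma smooth_on_lincomb:
  fixes f g :: "'e::real_normed_vector \<Rightarrow> complex"
  assumes "open S" "smooth_on S f" "smooth_on S g"
  shows "smooth_on S (\<lambda>x. a * f x + b * g x)"
  using assms unfolding smooth_on_def by (blast intro: Ck_on_lincomb)

lemma smooth_on_zero: "smooth_on S (\<lambda>x. 0 :: complex)"
proof -
  have "Ck_on k S (\<lambda>x. 0 :: complex)" for k
    by (induction k) auto
  then show ?thesis by (simp add: smooth_on_def)
qed

lemma smooth_on_sum:
  fixes f :: "'i \<Rightarrow> 'e::real_normed_vector \<Rightarrow> complex"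
  assumes "open S" "finite I" "\<And>i. i \<in> I \<Longrightarrow> smooth_on S (f i)"
  shows "smooth_on S (\<lambda>x. \<Sum>i\<in>I. c i * f i x)"
  using assms(2,3)
proof (induction I rule: finite_induct)
  case empty
  then show ?case by (simp add: smooth_on_zero)
next
  case (insert i I)
  then have "smooth_on S (\<lambda>x. c i * f i x + 1 * (\<Sum>i\<in>I. c i * f i x))"
    by (intro smooth_on_lincomb assms(1)) auto
  then show ?case using insert by simp
qed


section \<open>Symmetry of second derivatives\<close>

lemma DERIV_along_line:
  fixes g :: "'e::real_normed_vector \<Rightarrow> real"
  assumes "(g has_derivative G) (at (p + a *\<^sub>R u))"
  shows "DERIV (\<lambda>a. g (p + a *\<^sub>R u)) a :> G u"
proof -
  have "((\<lambda>a. p + a *\<^sub>R u) has_derivative (\<lambda>s. s *\<^sub>R u)) (at a)"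
    by (auto intro!: derivative_eq_intros)
  from diff_chain_at[OF this assms]
  have "((\<lambda>a. g (p + a *\<^sub>R u)) has_derivative (\<lambda>s. G (s *\<^sub>R u))) (at a)"
    by (simp add: o_def)
  moreover have "(\<lambda>s. G (s *\<^sub>R u)) = (*) (G u)"
    using linear_scale[OF has_derivative_linear[OF assms]] by (auto simp: mult.commute)
  ultimately show ?thesis by (simp add: has_field_derivative_def)
qed

text \<open>Two applications of the mean value theorem, first in direction \<open>v\<close> and then in direction
  \<open>w\<close>. The left-hand side is symmetric in \<open>v\<close> and \<open>w\<close>, which is where the symmetry of second
  derivatives comes from.\<close>

lemma second_difference_mvt:
  fixes f :: "'e::real_normed_vector \<Rightarrow> real"
  assumes f: "\<And>y. y \<in> S \<Longrightarrow> (f has_derivative F y) (at y)"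
    and F: "\<And>y. y \<in> S \<Longrightarrow> ((\<lambda>z. F z v) has_derivative G y) (at y)"
    and t: "t > 0" and inS: "\<And>a b. a \<in> {0..t} \<Longrightarrow> b \<in> {0..t} \<Longrightarrow> x + a *\<^sub>R v + b *\<^sub>R w \<in> S"
  obtains a b where "a \<in> {0..t}" "b \<in> {0..t}"
    "f (x + t *\<^sub>R v + t *\<^sub>R w) - f (x + t *\<^sub>R v) - f (x + t *\<^sub>R w) + f x
       = t * t * G (x + a *\<^sub>R v + b *\<^sub>R w) w"
proof -
  define \<phi> where "\<phi> a = f ((x + t *\<^sub>R w) + a *\<^sub>R v) - f (x + a *\<^sub>R v)" for a
  have "DERIV \<phi> a :> F ((x + t *\<^sub>R w) + a *\<^sub>R v) v - F (x + a *\<^sub>R v) v" if "0 \<le> a" "a \<le> t" for a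
    unfolding \<phi>_def
    using inS[of a t] inS[of a 0] that t
    by (intro DERIV_diff DERIV_along_line f) (auto simp: algebra_simps)
  from MVT2[OF t this] obtain a where a: "0 < a" "a < t"
    and \<phi>: "\<phi> t - \<phi> 0 = t * (F ((x + t *\<^sub>R w) + a *\<^sub>R v) v - F (x + a *\<^sub>R v) v)" by auto
  have "DERIV (\<lambda>b. F ((x + a *\<^sub>R v) + b *\<^sub>R w) v) b :> G ((x + a *\<^sub>R v) + b *\<^sub>R w) w"
    if "0 \<le> b" "b \<le> t" for b
    using inS[of a b] that a by (intro DERIV_along_line[of "\<lambda>z. F z v"] F) auto
  from MVT2[OF t this] obtain b where b: "0 < b" "b < t"
    and "F (x + a *\<^sub>R v + t *\<^sub>R w) v - F (x + a *\<^sub>R v) v = t * G (x + a *\<^sub>R v + b *\<^sub>R w) w" by auto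
  with \<phi> have "\<phi> t - \<phi> 0 = t * t * G (x + a *\<^sub>R v + b *\<^sub>R w) w"
    by (simp add: algebra_simps)
  with a b show ?thesis
    by (intro that[of a b]) (auto simp: \<phi>_def algebra_simps)
qed

text \<open>By continuity both second derivatives at \<open>x\<close> are limits of the second difference divided by
  \<open>t\<^sup>2\<close>.\<close>

lemma second_derivative_symmetric_real:
  fixes f :: "'e::real_normed_vector \<Rightarrow> real"
  assumes S: "open S" "x \<in> S"
    and f: "\<And>y. y \<in> S \<Longrightarrow> (f has_derivative F y) (at y)"
    and G: "\<And>y. y \<in> S \<Longrightarrow> ((\<lambda>z. F z v) has_derivative G y) (at y)"
    and H: "\<And>y. y \<in> S \<Longrightarrow> ((\<lambda>z. F z w) has_derivative H y) (at y)"
    and cont: "continuous_on S (\<lambda>y. G y w)" "continuous_on S (\<lambda>y. H y v)"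
  shows "G x w = H x v"
proof (rule ccontr)
  assume neq: "G x w \<noteq> H x v"
  \<comment> \<open>Two values within \<open>e\<close> of the two derivatives cannot coincide.\<close>
  define e where "e = \<bar>G x w - H x v\<bar> / 2"
  have e: "e > 0" using neq by (simp add: e_def)
  have "\<forall>\<^sub>F y in at x. dist (G y w) (G x w) < e" "\<forall>\<^sub>F y in at x. dist (H y v) (H x v) < e"
    using cont S e by (auto simp: continuous_on_eq_continuous_at isCont_def tendsto_iff)
  moreover have "\<forall>\<^sub>F y in at x. y \<in> S"
    using S by (simp add: eventually_at_in_open')
  ultimately have "\<forall>\<^sub>F y in at x. y \<in> S \<and> dist (G y w) (G x w) < e \<and> dist (H y v) (H x v) < e"
    by (auto intro: eventually_conj)
  then obtain d where d: "d > 0"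
    and near': "\<And>y. y \<noteq> x \<and> dist y x < d \<Longrightarrow>
      y \<in> S \<and> dist (G y w) (G x w) < e \<and> dist (H y v) (H x v) < e"
    unfolding eventually_at by auto
  have near: "y \<in> S \<and> dist (G y w) (G x w) < e \<and> dist (H y v) (H x v) < e" if "dist y x < d" for y
    using near'[of y] that S e by (cases "y = x") auto
  \<comment> \<open>The whole parallelogram spanned by \<open>t v\<close> and \<open>t w\<close> at \<open>x\<close> lies in the \<open>d\<close>-ball; the summand \<open>1\<close>
    keeps the denominator positive.\<close>
  define t where "t = d / (norm v + norm w + 1)"
  have t: "t > 0" using d by (auto simp: t_def intro!: divide_pos_pos add_nonneg_pos)
  have close: "dist (x + a *\<^sub>R v + b *\<^sub>R w) x < d" if "a \<in> {0..t}" "b \<in> {0..t}" for a b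
  proof -
    have "dist (x + a *\<^sub>R v + b *\<^sub>R w) x = norm (a *\<^sub>R v + b *\<^sub>R w)"
      by (simp add: dist_norm algebra_simps)
    also have "\<dots> \<le> a * norm v + b * norm w"
      using that by (intro order_trans[OF norm_triangle_ineq]) auto
    also have "\<dots> \<le> t * norm v + t * norm w"
      using that by (intro add_mono mult_right_mono) auto
    also have "\<dots> < t * (norm v + norm w + 1)" using t by (simp add: algebra_simps)
    also have "\<dots> = d"
      using norm_ge_zero[of v] norm_ge_zero[of w] by (simp add: t_def add_nonneg_eq_0_iff)
    finally show ?thesis .
  qed
  obtain a b where ab: "a \<in> {0..t}" "b \<in> {0..t}"
    and 1: "f (x + t *\<^sub>R v + t *\<^sub>R w) - f (x + t *\<^sub>R v) - f (x + t *\<^sub>R w) + f x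
       = t * t * G (x + a *\<^sub>R v + b *\<^sub>R w) w"
    using second_difference_mvt[where x = x and w = w, OF f G t] near close by blast
  have close': "x + a *\<^sub>R w + b *\<^sub>R v \<in> S" if "a \<in> {0..t}" "b \<in> {0..t}" for a b
    using near[OF close[OF that(2,1)]] by (simp add: algebra_simps)
  obtain b' a' where ab': "a' \<in> {0..t}" "b' \<in> {0..t}"
    and 2: "f (x + t *\<^sub>R w + t *\<^sub>R v) - f (x + t *\<^sub>R w) - f (x + t *\<^sub>R v) + f x
       = t * t * H (x + b' *\<^sub>R w + a' *\<^sub>R v) v"
    using second_difference_mvt[OF f H t close'] by blast
  have swap: "x + b *\<^sub>R w + a *\<^sub>R v = x + a *\<^sub>R v + b *\<^sub>R w" for a b
    by (simp add: algebra_simps)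
  from 1 2[unfolded swap[of t t] swap[of b' a']] have "t * t * G (x + a *\<^sub>R v + b *\<^sub>R w) w = t * t * H (x + a' *\<^sub>R v + b' *\<^sub>R w) v"
    by linarith
  then have "G (x + a *\<^sub>R v + b *\<^sub>R w) w = H (x + a' *\<^sub>R v + b' *\<^sub>R w) v"
    using t by simp
  moreover have "\<bar>G (x + a *\<^sub>R v + b *\<^sub>R w) w - G x w\<bar> < e"
    and "\<bar>H (x + a' *\<^sub>R v + b' *\<^sub>R w) v - H x v\<bar> < e"
    using near[OF close[OF ab]] near[OF close[OF ab']] by (simp_all add: dist_real_def)
  ultimately have "\<bar>G x w - H x v\<bar> < 2 * e" by linarith
  then show False by (simp add: e_def)
qed

text \<open>Schwarz's theorem, obtained from the real and imaginary parts.\<close>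

lemma frechet_derivative_commute:
  fixes f :: "'e::real_normed_vector \<Rightarrow> complex"
  assumes S: "open S" "x \<in> S" and f: "smooth_on S f"
  shows "frechet_derivative (\<lambda>y. frechet_derivative f (at y) v) (at x) w
       = frechet_derivative (\<lambda>y. frechet_derivative f (at y) w) (at x) v"
proof -
  let ?D = "\<lambda>y. frechet_derivative f (at y)"
  let ?D2 = "\<lambda>u y. frechet_derivative (\<lambda>y. ?D y u) (at y)"
  have D: "(f has_derivative ?D y) (at y)" if "y \<in> S" for y
    using smooth_on_differentiable[OF f that] by (simp add: frechet_derivative_works)
  have D2: "((\<lambda>y. ?D y u) has_derivative ?D2 u y) (at y)" if "y \<in> S" for y u
    using smooth_on_differentiable[OF smooth_on_frechet_derivative[OF f] that]
    by (simp add: frechet_derivative_works)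
  have cont: "continuous_on S (\<lambda>y. ?D2 u y u')" for u u'
    using smooth_on_frechet_derivative[OF smooth_on_frechet_derivative[OF f]]
    unfolding smooth_on_def by (metis Ck_on.simps(1))
  have part: "L (?D2 v x w) = L (?D2 w x v)" if L: "bounded_linear L" for L :: "complex \<Rightarrow> real"
    using bounded_linear.has_derivative[OF L D] bounded_linear.has_derivative[OF L D2]
      bounded_linear.continuous_on[OF L cont]
    by (intro second_derivative_symmetric_real[OF S]) auto
  show ?thesis
    using part[OF bounded_linear_Re] part[OF bounded_linear_Im] by (simp add: complex_eq_iff)
qed


section \<open>Wirtinger derivatives\<close>

text \<open>The two types of derivations and coframes are indexed by a Boolean, so that the facts about
  \<open>\<partial>\<close> and \<open>\<partial>bar\<close> below, and their mutual relations, become instances of one computation.\<close>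

definition wirtinger :: "bool \<Rightarrow> 'n::finite \<Rightarrow> (complex^'n \<Rightarrow> complex) \<Rightarrow> complex^'n \<Rightarrow> complex" where
  "wirtinger bar j f = (if bar then partial_zbar j f else partial_z j f)"

definition coframe :: "bool \<Rightarrow> 'n::finite \<Rightarrow> complex^'n \<Rightarrow> complex" where
  "coframe bar j v = (if bar then cnj (v $ j) else v $ j)"

text \<open>The coordinate expressions of \<open>\<partial>\<close> and \<open>\<partial>bar\<close>.\<close>

definition type_d :: "bool \<Rightarrow> (complex^'n::finite \<Rightarrow> (complex^'n) list \<Rightarrow> complex)
    \<Rightarrow> complex^'n \<Rightarrow> (complex^'n) list \<Rightarrow> complex" where
  "type_d bar f x vs =
     (\<Sum>j\<in>UNIV. wedge1 (coframe bar j) (\<lambda>ws. wirtinger bar j (\<lambda>y. f y ws) x) vs)"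

lemma wirtinger_eq:
  "wirtinger bar j f x = 1/2 * frechet_derivative f (at x) (axis j 1)
     + (if bar then \<i>/2 else - \<i>/2) * frechet_derivative f (at x) (axis j \<i>)"
  by (simp add: wirtinger_def partial_z_def partial_zbar_def field_simps)

lemma wirtinger_cong:
  assumes "open S" "x \<in> S" "g differentiable at x" "\<And>y. y \<in> S \<Longrightarrow> f y = g y"
  shows "wirtinger bar j f x = wirtinger bar j g x"
proof -
  have "frechet_derivative f (at x) = frechet_derivative g (at x)"
    using frechet_derivative_transform_within_open[OF assms(3,1,2), of f] assms(4) by auto
  then show ?thesis by (simp add: wirtinger_eq)
qed

lemma wirtinger_zero [simp]: "wirtinger bar j (\<lambda>y. 0) x = 0"
  by (simp add: wirtinger_eq)

lemma wirtinger_lincomb: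
  assumes "f differentiable at x" "g differentiable at x"
  shows "wirtinger bar j (\<lambda>y. a * f y + b * g y) x = a * wirtinger bar j f x + b * wirtinger bar j g x"
  by (simp add: wirtinger_eq frechet_derivative_lincomb[OF assms] algebra_simps)

lemma differentiable_sum_cmult:
  fixes f :: "'i \<Rightarrow> 'e::real_normed_vector \<Rightarrow> complex"
  assumes "finite I" "\<And>i. i \<in> I \<Longrightarrow> f i differentiable at x"
  shows "(\<lambda>y. \<Sum>i\<in>I. c i * f i y) differentiable at x"
  using assms by (intro differentiable_sum differentiable_mult) auto

lemma wirtinger_sum:
  assumes "finite I" "\<And>i. i \<in> I \<Longrightarrow> f i differentiable at x"
  shows "wirtinger bar j (\<lambda>y. \<Sum>i\<in>I. c i * f i y) x = (\<Sum>i\<in>I. c i * wirtinger bar j (f i) x)"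
  using assms
proof (induction I rule: finite_induct)
  case (insert i I)
  then have "wirtinger bar j (\<lambda>y. c i * f i y + 1 * (\<Sum>i\<in>I. c i * f i y)) x
    = c i * wirtinger bar j (f i) x + 1 * wirtinger bar j (\<lambda>y. \<Sum>i\<in>I. c i * f i y) x"
    by (intro wirtinger_lincomb differentiable_sum_cmult) auto
  with insert show ?case by simp
qed simp

lemma smooth_on_wirtinger:
  assumes "open S" "smooth_on S f"
  shows "smooth_on S (wirtinger bar j f)"
proof -
  have "wirtinger bar j f = (\<lambda>x. 1/2 * frechet_derivative f (at x) (axis j 1)
     + (if bar then \<i>/2 else - \<i>/2) * frechet_derivative f (at x) (axis j \<i>))"
    by (rule ext) (rule wirtinger_eq)
  then show ?thesis
    using assms by (simp only:) (intro smooth_on_lincomb smooth_on_frechet_derivative)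
qed

lemma wirtinger_commute:
  assumes S: "open S" "x \<in> S" and f: "smooth_on S f"
  shows "wirtinger b j (wirtinger c l f) x = wirtinger c l (wirtinger b j f) x"
proof -
  have *: "wirtinger c l f = (\<lambda>x. 1/2 * frechet_derivative f (at x) (axis l 1)
     + (if c then \<i>/2 else - \<i>/2) * frechet_derivative f (at x) (axis l \<i>))" for c l
    by (rule ext) (rule wirtinger_eq)
  have diff: "(\<lambda>y. frechet_derivative f (at y) v) differentiable at x" for v
    by (rule smooth_on_differentiable[OF smooth_on_frechet_derivative[OF f] S(2)])
  have D: "frechet_derivative (wirtinger c l f) (at x) v =
      1/2 * frechet_derivative (\<lambda>y. frechet_derivative f (at y) (axis l 1)) (at x) v
      + (if c then \<i>/2 else - \<i>/2)
          * frechet_derivative (\<lambda>y. frechet_derivative f (at y) (axis l \<i>)) (at x) v" for c l v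
    unfolding * by (rule frechet_derivative_lincomb[OF diff diff])
  have rearrange: "a * (a * p + s * q) + t * (a * p' + s * q') = a * (a * p + t * p') + s * (a * q + t * q')"
    for a s t p q p' q' :: complex
    by (simp add: algebra_simps)
  note comm = frechet_derivative_commute[OF S f]
  show ?thesis
    unfolding wirtinger_eq[of b j "wirtinger c l f"] wirtinger_eq[of c l "wirtinger b j f"] D
    unfolding comm[of "axis l 1" "axis j 1"] comm[of "axis l 1" "axis j \<i>"]
      comm[of "axis l \<i>" "axis j 1"] comm[of "axis l \<i>" "axis j \<i>"]
    by (rule rearrange)
qed

text \<open>A real-linear map is the sum of its complex-linear and its conjugate-linear part.\<close>

lemma frechet_derivative_wirtinger:
  fixes f :: "complex^'n::finite \<Rightarrow> complex"
  assumes "f differentiable at x"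
  shows "frechet_derivative f (at x) v =
    (\<Sum>j\<in>UNIV. coframe False j v * wirtinger False j f x + coframe True j v * wirtinger True j f x)"
proof -
  let ?D = "frechet_derivative f (at x)"
  have lin: "linear ?D" by (rule linear_frechet_derivative[OF assms])
  have v: "v = (\<Sum>j\<in>UNIV. Re (v $ j) *\<^sub>R axis j 1 + Im (v $ j) *\<^sub>R axis j \<i>)"
  proof (rule vec_eq_iff[THEN iffD2, rule_format])
    fix i
    have "(\<Sum>j\<in>UNIV. Re (v $ j) *\<^sub>R axis j 1 + Im (v $ j) *\<^sub>R axis j \<i>) $ i
      = (\<Sum>j\<in>UNIV. if j = i then v $ j else 0)"
      unfolding sum_component
      by (intro sum.cong) (auto simp: axis_def complex_eq_iff)
    then show "v $ i = (\<Sum>j\<in>UNIV. Re (v $ j) *\<^sub>R axis j 1 + Im (v $ j) *\<^sub>R axis j \<i>) $ i"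
      by simp
  qed
  have "?D v = (\<Sum>j\<in>UNIV. Re (v $ j) *\<^sub>R ?D (axis j 1) + Im (v $ j) *\<^sub>R ?D (axis j \<i>))"
    by (rule trans[OF arg_cong[OF v, of ?D]])
      (simp only: linear_sum[OF lin] linear_add[OF lin] linear_scale[OF lin])
  also have "\<dots> = (\<Sum>j\<in>UNIV. coframe False j v * wirtinger False j f x
      + coframe True j v * wirtinger True j f x)"
  proof (rule sum.cong[OF refl])
    fix j
    have "Re z *\<^sub>R p + Im z *\<^sub>R q =
      z * (1/2 * p + (- \<i>/2) * q) + cnj z * (1/2 * p + \<i>/2 * q)" for z p q
      by (simp add: complex_eq_iff field_simps)
    then show "Re (v $ j) *\<^sub>R ?D (axis j 1) + Im (v $ j) *\<^sub>R ?D (axis j \<i>) =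
        coframe False j v * wirtinger False j f x + coframe True j v * wirtinger True j f x"
      by (simp add: wirtinger_eq coframe_def)
  qed
  finally show ?thesis .
qed


section \<open>Exterior products with covectors\<close>

lemma wedge1_Nil [simp]: "wedge1 \<alpha> \<eta> [] = 0"
  by (simp add: wedge1_def)

lemma wedge1_Cons:
  "wedge1 \<alpha> \<eta> (v # vs) = \<alpha> v * \<eta> vs - wedge1 \<alpha> (\<lambda>ws. \<eta> (v # ws)) vs"
proof -
  have "delete_nth (Suc i) (v # vs) = v # delete_nth i vs" for i
    by (simp add: delete_nth_def)
  then show ?thesis
    by (simp add: wedge1_def sum.lessThan_Suc_shift sum_negf delete_nth_def del: sum.lessThan_Suc)
qed

lemma wedge1_lincomb:
  "wedge1 \<alpha> (\<lambda>ws. a * \<eta> ws + b * \<theta> ws) vs = a * wedge1 \<alpha> \<eta> vs + b * wedge1 \<alpha> \<theta> vs"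
  by (simp add: wedge1_def sum.distrib sum_distrib_left algebra_simps)

lemma wedge1_sum:
  "wedge1 \<alpha> (\<lambda>ws. \<Sum>j\<in>I. \<eta> j ws) vs = (\<Sum>j\<in>I. wedge1 \<alpha> (\<eta> j) vs)"
  unfolding wedge1_def sum_distrib_left by (rule sum.swap)

text \<open>Splitting off the first argument \<open>v\<close> leaves \<open>\<alpha>(v) \<beta> \<and> \<eta> - \<beta>(v) \<alpha> \<and> \<eta>\<close>, which changes sign when \<open>\<alpha>\<close>
  and \<open>\<beta>\<close> are exchanged, and a double product with one argument less.\<close>

lemma wedge1_anticommute: "wedge1 \<alpha> (wedge1 \<beta> \<eta>) vs = - wedge1 \<beta> (wedge1 \<alpha> \<eta>) vs"
proof (induction vs arbitrary: \<eta>)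
  case (Cons v vs)
  have "wedge1 \<alpha> (\<lambda>ws. wedge1 \<beta> \<eta> (v # ws)) vs =
    \<beta> v * wedge1 \<alpha> \<eta> vs - wedge1 \<alpha> (wedge1 \<beta> (\<lambda>ws. \<eta> (v # ws))) vs" for \<alpha> \<beta>
    using wedge1_lincomb[of \<alpha> "\<beta> v" \<eta> "-1" "wedge1 \<beta> (\<lambda>ws. \<eta> (v # ws))" vs]
    by (simp add: wedge1_Cons)
  then show ?case by (simp add: wedge1_Cons[of _ "wedge1 _ \<eta>"] Cons.IH)
qed simp

lemma wirtinger_wedge1:
  assumes "\<And>ws. (\<lambda>y. f y ws) differentiable at x"
  shows "wirtinger bar j (\<lambda>y. wedge1 \<alpha> (f y) vs) x
       = wedge1 \<alpha> (\<lambda>ws. wirtinger bar j (\<lambda>y. f y ws) x) vs"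
  unfolding wedge1_def by (rule wirtinger_sum) (use assms in auto)

lemma smooth_on_wedge1:
  assumes "open S" "\<And>ws. smooth_on S (\<lambda>y. f y ws)"
  shows "smooth_on S (\<lambda>y. wedge1 \<alpha> (f y) vs)"
  unfolding wedge1_def by (rule smooth_on_sum) (use assms in auto)

lemma smooth_on_type_d:
  assumes "open S" "\<And>ws. smooth_on S (\<lambda>y. f y ws)"
  shows "smooth_on S (\<lambda>y. type_d bar f y vs)"
proof -
  have "smooth_on S (\<lambda>y. \<Sum>j\<in>UNIV. 1 * wedge1 (coframe bar j) (\<lambda>ws. wirtinger bar j (\<lambda>y. f y ws) y) vs)"
    using assms by (intro smooth_on_sum smooth_on_wedge1 smooth_on_wirtinger) auto
  then show ?thesis by (simp add: type_d_def)
qed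

lemma type_d_cong:
  assumes "open S" "x \<in> S" "\<And>ws. (\<lambda>y. g y ws) differentiable at x"
    and "\<And>y ws. y \<in> S \<Longrightarrow> f y ws = g y ws"
  shows "type_d bar f x vs = type_d bar g x vs"
proof -
  have "wirtinger bar j (\<lambda>y. f y ws) x = wirtinger bar j (\<lambda>y. g y ws) x" for j ws
    by (rule wirtinger_cong) (use assms in auto)
  then show ?thesis by (simp add: type_d_def)
qed

lemma type_d_lincomb:
  assumes "\<And>ws. (\<lambda>y. f y ws) differentiable at x" "\<And>ws. (\<lambda>y. g y ws) differentiable at x"
  shows "type_d bar (\<lambda>y ws. a * f y ws + b * g y ws) x vs
       = a * type_d bar f x vs + b * type_d bar g x vs"
  by (simp add: type_d_def wirtinger_lincomb[OF assms] wedge1_lincomb sum.distrib sum_distrib_left)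

text \<open>The coframes are constant in coordinates, so the operators anticommute because covectors
  anticommute whereas derivations commute. For equal types this says that \<open>\<partial>\<^sup>2 = 0\<close> and
  \<open>\<partial>bar\<^sup>2 = 0\<close>.\<close>

lemma type_d_anticommute:
  assumes S: "open S" "x \<in> S" and f: "\<And>ws. smooth_on S (\<lambda>y. f y ws)"
  shows "type_d b (type_d c f) x vs = - type_d c (type_d b f) x vs"
proof -
  have expand: "type_d b (type_d c f) x vs =
      (\<Sum>j\<in>UNIV. \<Sum>l\<in>UNIV. wedge1 (coframe b j) (wedge1 (coframe c l)
        (\<lambda>ws. wirtinger b j (wirtinger c l (\<lambda>y. f y ws)) x)) vs)" for b c
  proof -
    have diff: "(wirtinger c l (\<lambda>y. f y ws)) differentiable at x" for l ws
      using smooth_on_differentiable[OF smooth_on_wirtinger[OF S(1) f] S(2)] .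
    have diff_wedge: "(\<lambda>y. wedge1 (coframe c l) (\<lambda>us. wirtinger c l (\<lambda>z. f z us) y) ws) differentiable at x"
      for l ws
      using smooth_on_differentiable[OF smooth_on_wedge1[OF S(1) smooth_on_wirtinger[OF S(1) f]] S(2)] .
    have "wirtinger b j (\<lambda>y. type_d c f y ws) x =
      (\<Sum>l\<in>UNIV. wedge1 (coframe c l) (\<lambda>us. wirtinger b j (wirtinger c l (\<lambda>z. f z us)) x) ws)" for j ws
    proof -
      have "wirtinger b j (\<lambda>y. \<Sum>l\<in>UNIV. 1 * wedge1 (coframe c l) (\<lambda>us. wirtinger c l (\<lambda>z. f z us) y) ws) x =
        (\<Sum>l\<in>UNIV. 1 * wirtinger b j (\<lambda>y. wedge1 (coframe c l) (\<lambda>us. wirtinger c l (\<lambda>z. f z us) y) ws) x)"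
        by (rule wirtinger_sum) (auto intro: diff_wedge)
      moreover have "wirtinger b j (\<lambda>y. wedge1 (coframe c l) (\<lambda>us. wirtinger c l (\<lambda>z. f z us) y) ws) x =
        wedge1 (coframe c l) (\<lambda>us. wirtinger b j (wirtinger c l (\<lambda>z. f z us)) x) ws" for l
        by (rule wirtinger_wedge1) (rule diff)
      ultimately show ?thesis by (simp add: type_d_def)
    qed
    then show ?thesis
      unfolding type_d_def[of b] by (simp add: wedge1_sum)
  qed
  have "type_d b (type_d c f) x vs =
      (\<Sum>j\<in>UNIV. \<Sum>l\<in>UNIV. - wedge1 (coframe c l) (wedge1 (coframe b j)
        (\<lambda>ws. wirtinger c l (wirtinger b j (\<lambda>y. f y ws)) x)) vs)"
    unfolding expand wedge1_anticommute[of "coframe b _"] wirtinger_commute[OF S f, of b _ c] ..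
  also have "\<dots> = - type_d c (type_d b f) x vs"
    unfolding expand sum_negf by (subst sum.swap) simp
  finally show ?thesis .
qed


section \<open>Rescaling the components of pure type\<close>

text \<open>Let \<open>T\<close> be the endomorphism of the complexified tangent space that is multiplication by \<open>h\<close> on
  vectors of type \<open>(1,0)\<close> and the identity on vectors of type \<open>(0,1)\<close>. On a real vector \<open>v\<close> it is
  \<open>T v = (1 + h)/2 \<otimes> v + \<i> (1 - h)/2 \<otimes> J v\<close>, where \<open>J v\<close> is \<open>\<i> *s v\<close> and the first \<open>\<i>\<close> comes from the
  complexification. The pullback of a form along \<open>T\<close>, which multiplies the component of type
  \<open>(p,q)\<close> by \<open>h\<^sup>p\<close>, is obtained by expanding multilinearly. Recursion along the arguments gives it
  without a decomposition into pure types.\<close>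

fun type_scale :: "complex \<Rightarrow> ((complex^'n::finite) list \<Rightarrow> complex) \<Rightarrow> (complex^'n) list \<Rightarrow> complex" where
  "type_scale h \<eta> [] = \<eta> []"
| "type_scale h \<eta> (v # vs) = (1 + h)/2 * type_scale h (\<lambda>ws. \<eta> (v # ws)) vs
     + \<i> * (1 - h)/2 * type_scale h (\<lambda>ws. \<eta> ((\<i> *s v) # ws)) vs"

lemma type_scale_lincomb:
  "type_scale h (\<lambda>ws. a * \<eta> ws + b * \<theta> ws) vs = a * type_scale h \<eta> vs + b * type_scale h \<theta> vs"
proof (induction vs arbitrary: \<eta> \<theta>)
  case (Cons v vs)
  show ?case by (simp add: Cons.IH algebra_simps)
qed simp

lemma type_scale_zero [simp]: "type_scale h (\<lambda>ws. 0) vs = 0"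
  by (induction vs) auto

lemma type_scale_sum:
  "finite I \<Longrightarrow> type_scale h (\<lambda>ws. \<Sum>j\<in>I. \<eta> j ws) vs = (\<Sum>j\<in>I. type_scale h (\<eta> j) vs)"
proof (induction I rule: finite_induct)
  case (insert j I)
  then show ?case
    using type_scale_lincomb[of h 1 "\<eta> j" 1 "\<lambda>ws. \<Sum>j\<in>I. \<eta> j ws" vs] by simp
qed simp

lemma type_scale_one: "type_scale 1 \<eta> vs = \<eta> vs"
  by (induction vs arbitrary: \<eta>) auto

text \<open>The eigenvalues of \<open>T\<close>, read off on \<open>dz\<^sub>j\<close> and \<open>dzbar\<^sub>j\<close>.\<close>

lemma type_scale_coefficients:
  fixes h z :: complex
  shows "(1 + h)/2 * z + \<i> * (1 - h)/2 * (\<i> * z) = h * z"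
    and "(1 + h)/2 * z + \<i> * (1 - h)/2 * (- \<i> * z) = z"
proof -
  have "\<i> * (\<i> * w) = - w" for w by (simp flip: mult.assoc)
  then show "(1 + h)/2 * z + \<i> * (1 - h)/2 * (\<i> * z) = h * z"
    and "(1 + h)/2 * z + \<i> * (1 - h)/2 * (- \<i> * z) = z"
    by (simp_all add: algebra_simps add_divide_distrib diff_divide_distrib)
qed

lemma type_scale_coefficients_mult:
  fixes a b p q :: complex
  shows "(1 + a)/2 * ((1 + b)/2 * p + \<i> * (1 - b)/2 * q)
      + \<i> * (1 - a)/2 * ((1 + b)/2 * q + \<i> * (1 - b)/2 * (- p))
      = (1 + a * b)/2 * p + \<i> * (1 - a * b)/2 * q"
proof -
  have "\<i> * (\<i> * w) = - w" for w by (simp flip: mult.assoc)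
  then show ?thesis by (simp add: algebra_simps add_divide_distrib diff_divide_distrib)
qed

text \<open>The conditions of \<open>alternating_form\<close> are reformulated for lists of arbitrary length, and
  vanishing on repeated arguments is replaced by skewness under adjacent transpositions. These
  versions are inherited when the first argument is fixed, which the recursion defining
  \<open>type_scale\<close> requires.\<close>

definition multilinear :: "((complex^'n::finite) list \<Rightarrow> complex) \<Rightarrow> bool" where
  "multilinear \<eta> \<longleftrightarrow> (\<forall>xs ys. linear (\<lambda>v. \<eta> (xs @ v # ys)))"

definition swap_skew :: "('v list \<Rightarrow> complex) \<Rightarrow> bool" where
  "swap_skew \<eta> \<longleftrightarrow> (\<forall>xs v w ys. \<eta> (xs @ v # w # ys) = - \<eta> (xs @ w # v # ys))"

lemma multilinear_Cons: "multilinear \<eta> \<Longrightarrow> multilinear (\<lambda>ws. \<eta> (v # ws))"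
  unfolding multilinear_def by (simp flip: append_Cons)

lemma swap_skewD: "swap_skew \<eta> \<Longrightarrow> \<eta> (xs @ v # w # ys) = - \<eta> (xs @ w # v # ys)"
  unfolding swap_skew_def by blast

lemma swap_skew_Cons:
  assumes "swap_skew \<eta>" shows "swap_skew (\<lambda>ws. \<eta> (v # ws))"
  unfolding swap_skew_def
proof (intro allI)
  fix xs a b ys
  show "\<eta> (v # xs @ a # b # ys) = - \<eta> (v # xs @ b # a # ys)"
    by (rule swap_skewD[OF assms, of "v # xs" a b ys, unfolded append_Cons])
qed

lemma multilinear_uminus_first:
  assumes "multilinear \<eta>" shows "\<eta> ((- v) # vs) = - \<eta> (v # vs)"
proof -
  have "linear (\<lambda>v. \<eta> ([] @ v # vs))" using assms by (simp only: multilinear_def)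
  from linear_neg[OF this, of v] show ?thesis by simp
qed

text \<open>Since \<open>J\<^sup>2 = -1\<close>, the endomorphisms for \<open>a\<close> and \<open>b\<close> compose to the one for \<open>a * b\<close>.\<close>

lemma type_scale_mult:
  assumes "multilinear \<eta>"
  shows "type_scale a (type_scale b \<eta>) vs = type_scale (a * b) \<eta> vs"
  using assms
proof (induction vs arbitrary: \<eta>)
  case (Cons v vs)
  let ?s = "\<lambda>v. type_scale (a * b) (\<lambda>ws. \<eta> (v # ws)) vs"
  have step: "type_scale a (\<lambda>ws. type_scale b \<eta> (v # ws)) vs =
     (1 + b)/2 * ?s v + \<i> * (1 - b)/2 * ?s (\<i> *s v)" for v
    by (simp only: type_scale.simps(2) type_scale_lincomb Cons.IH[OF multilinear_Cons[OF Cons.prems]])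
  have "\<i> *s (\<i> *s v) = - v" by (simp add: vector_smult_assoc)
  then have "?s (\<i> *s (\<i> *s v)) = type_scale (a * b) (\<lambda>ws. - \<eta> (v # ws)) vs"
    using multilinear_uminus_first[OF Cons.prems] by simp
  also have "\<dots> = - ?s v"
    using type_scale_lincomb[of "a * b" "-1" "\<lambda>ws. \<eta> (v # ws)" 0 "\<lambda>_. 0" vs] by simp
  finally have JJ: "?s (\<i> *s (\<i> *s v)) = - ?s v" .
  have "type_scale a (type_scale b \<eta>) (v # vs) =
      (1 + a)/2 * ((1 + b)/2 * ?s v + \<i> * (1 - b)/2 * ?s (\<i> *s v)) +
      \<i> * (1 - a)/2 * ((1 + b)/2 * ?s (\<i> *s v) + \<i> * (1 - b)/2 * (- ?s v))"
    unfolding type_scale.simps(2)[of a "type_scale b \<eta>"] step JJ ..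
  also have "\<dots> = (1 + a * b)/2 * ?s v + \<i> * (1 - a * b)/2 * ?s (\<i> *s v)"
    by (rule type_scale_coefficients_mult)
  also have "\<dots> = type_scale (a * b) \<eta> (v # vs)"
    by (rule type_scale.simps(2)[symmetric])
  finally show ?case .
qed simp

text \<open>The pullback along \<open>T\<close> multiplies \<open>dz\<^sub>j\<close> by \<open>h\<close> and fixes \<open>dzbar\<^sub>j\<close>.\<close>

lemma type_scale_wedge1:
  "type_scale h (wedge1 (coframe bar j) \<eta>) vs
     = (if bar then 1 else h) * wedge1 (coframe bar j) (type_scale h \<eta>) vs"
proof (induction vs arbitrary: \<eta>)
  case (Cons v vs)
  let ?\<alpha> = "coframe bar j" and ?c = "if bar then 1 else h"
  have step: "type_scale h (\<lambda>ws. wedge1 ?\<alpha> \<eta> (v # ws)) vs =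
      ?\<alpha> v * type_scale h \<eta> vs - ?c * wedge1 ?\<alpha> (type_scale h (\<lambda>ws. \<eta> (v # ws))) vs" for v
    using type_scale_lincomb[of h "?\<alpha> v" \<eta> "-1" "wedge1 ?\<alpha> (\<lambda>ws. \<eta> (v # ws))" vs]
    unfolding wedge1_Cons Cons.IH by simp
  have T: "(1 + h)/2 * ?\<alpha> v + \<i> * (1 - h)/2 * ?\<alpha> (\<i> *s v) = ?c * ?\<alpha> v"
    using type_scale_coefficients(1)[of h "v $ j"] type_scale_coefficients(2)[of h "cnj (v $ j)"]
    by (cases bar) (simp_all add: coframe_def)
  have split: "wedge1 ?\<alpha> (\<lambda>ws. type_scale h \<eta> (v # ws)) vs =
      (1 + h)/2 * wedge1 ?\<alpha> (type_scale h (\<lambda>ws. \<eta> (v # ws))) vs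
      + \<i> * (1 - h)/2 * wedge1 ?\<alpha> (type_scale h (\<lambda>ws. \<eta> ((\<i> *s v) # ws))) vs"
    by (simp only: type_scale.simps(2) wedge1_lincomb)
  have rearrange: "a * (p * s - c * q) + b * (p' * s - c * q') = (a * p + b * p') * s - c * (a * q + b * q')"
    for a b c p q s p' q' :: complex
    by (simp add: algebra_simps)
  have "type_scale h (wedge1 ?\<alpha> \<eta>) (v # vs) =
      ((1 + h)/2 * ?\<alpha> v + \<i> * (1 - h)/2 * ?\<alpha> (\<i> *s v)) * type_scale h \<eta> vs
      - ?c * wedge1 ?\<alpha> (\<lambda>ws. type_scale h \<eta> (v # ws)) vs"
    unfolding type_scale.simps(2)[of h "wedge1 ?\<alpha> \<eta>"] step split
    by (rule rearrange)
  also have "\<dots> = ?c * wedge1 ?\<alpha> (type_scale h \<eta>) (v # vs)"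
    unfolding T wedge1_Cons[of _ "type_scale h \<eta>"] by (simp only: right_diff_distrib mult.assoc)
  finally show ?case .
qed simp

lemma smooth_on_type_scale:
  assumes "open S" "\<And>ws. smooth_on S (\<lambda>y. f y ws)"
  shows "smooth_on S (\<lambda>y. type_scale h (f y) vs)"
  using assms(2)
proof (induction vs arbitrary: f)
  case (Cons v vs)
  have smooth: "smooth_on S (\<lambda>y. type_scale h (\<lambda>ws. f y (w # ws)) vs)" for w
    by (rule Cons.IH[of "\<lambda>y ws. f y (w # ws)"]) (rule Cons.prems)
  show ?case unfolding type_scale.simps(2) by (rule smooth_on_lincomb[OF assms(1) smooth smooth])
qed simp

lemma wirtinger_type_scale:
  assumes "\<And>ws. (\<lambda>y. f y ws) differentiable at x"
  shows "(\<lambda>y. type_scale h (f y) vs) differentiable at x"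
    and "wirtinger bar j (\<lambda>y. type_scale h (f y) vs) x
       = type_scale h (\<lambda>ws. wirtinger bar j (\<lambda>y. f y ws) x) vs"
proof -
  have "(\<lambda>y. type_scale h (f y) vs) differentiable at x \<and>
    wirtinger bar j (\<lambda>y. type_scale h (f y) vs) x
       = type_scale h (\<lambda>ws. wirtinger bar j (\<lambda>y. f y ws) x) vs"
    using assms
  proof (induction vs arbitrary: f)
    case (Cons v vs)
    have diff: "(\<lambda>y. type_scale h (\<lambda>ws. f y (w # ws)) vs) differentiable at x"
      and wirt: "wirtinger bar j (\<lambda>y. type_scale h (\<lambda>ws. f y (w # ws)) vs) x
        = type_scale h (\<lambda>ws. wirtinger bar j (\<lambda>y. f y (w # ws)) x) vs" for w
      using Cons.IH[of "\<lambda>y ws. f y (w # ws)"] Cons.prems by auto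
    show ?case unfolding type_scale.simps(2) wirtinger_lincomb[OF diff diff] wirt
      by (intro conjI differentiable_lincomb diff refl)
  qed simp
  then show "(\<lambda>y. type_scale h (f y) vs) differentiable at x"
    "wirtinger bar j (\<lambda>y. type_scale h (f y) vs) x
       = type_scale h (\<lambda>ws. wirtinger bar j (\<lambda>y. f y ws) x) vs" by auto
qed

lemma type_scale_type_d:
  assumes "\<And>ws. (\<lambda>y. f y ws) differentiable at x"
  shows "type_scale h (type_d bar f x) vs
       = (if bar then 1 else h) * type_d bar (\<lambda>y. type_scale h (f y)) x vs"
proof -
  have "type_scale h (type_d bar f x) vs = (\<Sum>j\<in>UNIV. type_scale h
      (wedge1 (coframe bar j) (\<lambda>ws. wirtinger bar j (\<lambda>y. f y ws) x)) vs)"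
    by (simp add: type_d_def[abs_def] type_scale_sum)
  also have "\<dots> = (if bar then 1 else h) * type_d bar (\<lambda>y. type_scale h (f y)) x vs"
    by (simp only: type_scale_wedge1 type_d_def sum_distrib_left wirtinger_type_scale(2)[OF assms])
  finally show ?thesis .
qed


section \<open>Alternating forms under rescaling\<close>

lemma linear_complex_lincomb:
  fixes f g :: "'v::real_vector \<Rightarrow> complex"
  assumes "linear f" "linear g"
  shows "linear (\<lambda>v. a * f v + b * g v)"
  by (rule linearI)
    (simp_all add: linear_add[OF assms(1)] linear_add[OF assms(2)]
      linear_scale[OF assms(1)] linear_scale[OF assms(2)] algebra_simps)

lemma linear_type_scale:
  assumes "\<And>ws. linear (\<lambda>v. F v ws)"
  shows "linear (\<lambda>v. type_scale h (F v) vs)"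
proof (rule linearI)
  fix v w r
  have "F (v + w) = (\<lambda>ws. F v ws + F w ws)" "F (r *\<^sub>R v) = (\<lambda>ws. of_real r * F v ws)"
    by (simp_all add: fun_eq_iff linear_add[OF assms] linear_scale[OF assms] scaleR_conv_of_real)
  then show "type_scale h (F (v + w)) vs = type_scale h (F v) vs + type_scale h (F w) vs"
    and "type_scale h (F (r *\<^sub>R v)) vs = r *\<^sub>R type_scale h (F v) vs"
    using type_scale_lincomb[of h 1 "F v" 1 "F w" vs]
      type_scale_lincomb[of h "of_real r" "F v" 0 "\<lambda>_. 0" vs]
    by (simp_all add: scaleR_conv_of_real)
qed

lemma linear_imaginary_unit: "linear (\<lambda>v::complex^'n::finite. \<i> *s v)"
  by (rule linearI) (simp_all add: vec_eq_iff algebra_simps)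

lemma multilinear_type_scale:
  assumes "multilinear \<eta>"
  shows "multilinear (type_scale h \<eta>)"
proof -
  have "linear (\<lambda>v. type_scale h \<eta> (xs @ v # ys))" for xs ys
    using assms
  proof (induction xs arbitrary: \<eta>)
    case Nil
    have lin: "linear (\<lambda>v. \<eta> (v # ws))" for ws
      using Nil[unfolded multilinear_def, rule_format, of "[]" ws] by simp
    have "linear (\<lambda>v. type_scale h (\<lambda>ws. \<eta> (v # ws)) ys)"
      by (rule linear_type_scale) (rule lin)
    moreover have "linear (\<lambda>v. type_scale h (\<lambda>ws. \<eta> ((\<i> *s v) # ws)) ys)"
      using linear_compose[OF linear_imaginary_unit lin]
      by (intro linear_type_scale) (simp add: o_def)
    ultimately show ?case
      unfolding append_Nil type_scale.simps(2) by (rule linear_complex_lincomb)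
  next
    case (Cons a xs)
    have "linear (\<lambda>v. type_scale h (\<lambda>ws. \<eta> (b # ws)) (xs @ v # ys))" for b
      by (rule Cons.IH) (rule multilinear_Cons[OF Cons.prems])
    then show ?case
      unfolding append_Cons type_scale.simps(2) by (intro linear_complex_lincomb)
  qed
  then show ?thesis by (simp add: multilinear_def)
qed

lemma swap_skew_type_scale:
  assumes "swap_skew \<eta>"
  shows "swap_skew (type_scale h \<eta>)"
proof -
  have "type_scale h \<eta> (xs @ v # w # ys) = - type_scale h \<eta> (xs @ w # v # ys)" for xs v w ys
    using assms
  proof (induction xs arbitrary: \<eta>)
    case Nil
    let ?s = "\<lambda>v w. type_scale h (\<lambda>ws. \<eta> (v # w # ws)) ys"
    have skew: "?s v w = - ?s w v" for v w
    proof -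
      have "(\<lambda>ws. \<eta> (v # w # ws)) = (\<lambda>ws. - 1 * \<eta> (w # v # ws) + 0 * 0)"
        using swap_skewD[OF Nil, of "[]" v w] by (auto simp: fun_eq_iff)
      then show ?thesis
        using type_scale_lincomb[of h "-1" "\<lambda>ws. \<eta> (w # v # ws)" 0 "\<lambda>_. 0" ys] by simp
    qed
    have rearrange: "a * (a * - p + b * - q) + b * (a * - r + b * - s) =
        - (a * (a * p + b * r) + b * (a * q + b * s))" for a b p q r s :: complex
      by (simp add: algebra_simps)
    show ?case
      unfolding append_Nil type_scale.simps(2)
        skew[of v w] skew[of "\<i> *s v" w] skew[of v "\<i> *s w"] skew[of "\<i> *s v" "\<i> *s w"]
      by (rule rearrange)
  next
    case (Cons a xs)
    have IH: "type_scale h (\<lambda>ws. \<eta> (b # ws)) (xs @ v # w # ys)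
        = - type_scale h (\<lambda>ws. \<eta> (b # ws)) (xs @ w # v # ys)" for b
      by (rule Cons.IH) (rule swap_skew_Cons[OF Cons.prems])
    show ?case
      unfolding append_Cons type_scale.simps(2) IH[of a] IH[of "\<i> *s a"] by (simp only: mult_minus_right minus_add_distrib)
  qed
  then show ?thesis unfolding swap_skew_def by blast
qed

text \<open>Transpositions bring the two equal arguments next to each other.\<close>

lemma swap_skew_repeated:
  assumes "swap_skew \<eta>"
  shows "\<eta> (xs @ v # ys @ v # zs) = 0"
proof (induction ys arbitrary: xs)
  case Nil
  have "\<eta> (xs @ v # v # zs) = - \<eta> (xs @ v # v # zs)" by (rule swap_skewD[OF assms])
  then show ?case by simp
next
  case (Cons w ys)
  have "\<eta> (xs @ v # w # ys @ v # zs) = - \<eta> (xs @ w # v # ys @ v # zs)"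
    by (rule swap_skewD[OF assms])
  also have "\<dots> = 0" using Cons.IH[of "xs @ [w]"] by simp
  finally show ?case by simp
qed

text \<open>Skewness under adjacent transpositions comes from vanishing on repeated arguments by
  polarization.\<close>

lemma alternating_form_iff:
  "alternating_form k \<eta> \<longleftrightarrow>
     (\<forall>vs. int (length vs) \<noteq> k \<longrightarrow> \<eta> vs = 0) \<and> multilinear \<eta> \<and> swap_skew \<eta>"
proof
  assume alt: "alternating_form k \<eta>"
  then have len: "\<eta> vs = 0" if "int (length vs) \<noteq> k" for vs
    using that by (simp add: alternating_form_def)
  have lin: "linear (\<lambda>v. \<eta> (xs @ v # ys))" for xs ys
  proof (cases "int (length (xs @ 0 # ys)) = k")
    case True
    have "linear (\<lambda>v. \<eta> (vs[i := v]))" if "int (length vs) = k" "i < length vs" for vs i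
      using alt that unfolding alternating_form_def by blast
    from this[OF True, of "length xs"] show ?thesis by simp
  next
    case False
    then have "\<eta> (xs @ v # ys) = 0" for v by (intro len) simp
    then show ?thesis by (simp add: linear_zero)
  qed
  have "\<eta> (xs @ v # w # ys) = - \<eta> (xs @ w # v # ys)" for xs v w ys
  proof -
    have rep: "\<eta> (xs @ u # u # ys) = 0" for u
      using alt len[of "xs @ u # u # ys"] unfolding alternating_form_def
      by (cases "int (length (xs @ u # u # ys)) = k") auto
    have add1: "\<eta> (xs @ (a + b) # c # ys) = \<eta> (xs @ a # c # ys) + \<eta> (xs @ b # c # ys)" for a b c
      using linear_add[OF lin[of xs "c # ys"]] .
    have add2: "\<eta> (xs @ c # (a + b) # ys) = \<eta> (xs @ c # a # ys) + \<eta> (xs @ c # b # ys)" for a b c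
      using linear_add[OF lin[of "xs @ [c]" ys], of a b] by simp
    have "\<eta> (xs @ v # w # ys) + \<eta> (xs @ w # v # ys) = 0"
      using rep[of "v + w"] unfolding add1 add2 by (simp add: rep add.commute)
    then show ?thesis by (simp add: eq_neg_iff_add_eq_0)
  qed
  then have "swap_skew \<eta>" unfolding swap_skew_def by blast
  with len lin show "(\<forall>vs. int (length vs) \<noteq> k \<longrightarrow> \<eta> vs = 0) \<and> multilinear \<eta> \<and> swap_skew \<eta>"
    by (simp add: multilinear_def)
next
  assume *: "(\<forall>vs. int (length vs) \<noteq> k \<longrightarrow> \<eta> vs = 0) \<and> multilinear \<eta> \<and> swap_skew \<eta>"
  have "linear (\<lambda>v. \<eta> (vs[i := v]))" if "i < length vs" for vs i
    using * that by (simp add: multilinear_def upd_conv_take_nth_drop)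
  moreover have "\<eta> vs = 0" if nd: "\<not> distinct vs" for vs
  proof -
    obtain xs ys zs y where "vs = xs @ [y] @ ys @ [y] @ zs"
      using not_distinct_decomp[OF nd] by blast
    then show ?thesis using swap_skew_repeated[of \<eta> xs y ys zs] * by simp
  qed
  ultimately show "alternating_form k \<eta>" using * by (simp add: alternating_form_def)
qed

lemma type_scale_eq_zero:
  assumes "\<And>ws. length ws = length vs \<Longrightarrow> \<eta> ws = 0"
  shows "type_scale h \<eta> vs = 0"
  using assms by (induction vs arbitrary: \<eta>) auto

lemma alternating_form_type_scale:
  assumes "alternating_form k \<eta>"
  shows "alternating_form k (type_scale h \<eta>)"
  using assms unfolding alternating_form_iff
  by (auto intro: multilinear_type_scale swap_skew_type_scale type_scale_eq_zero)

lemma alternating_form_cmult: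
  fixes \<eta> :: "(complex^'n::finite) list \<Rightarrow> complex"
  assumes "alternating_form k \<eta>"
  shows "alternating_form k (\<lambda>vs. a * \<eta> vs)"
proof -
  have "linear (\<lambda>v. a * f v)" if "linear f" for f :: "complex^'n \<Rightarrow> complex"
    using linear_complex_lincomb[OF that that, of a 0] by simp
  with assms show ?thesis unfolding alternating_form_def by simp
qed

lemma type_scale_pullback:
  assumes "\<And>v. D (\<i> *s v) = \<i> *s D v"
  shows "type_scale h (\<lambda>ws. \<eta> (map D ws)) vs = type_scale h \<eta> (map D vs)"
proof (induction vs arbitrary: \<eta>)
  case (Cons v vs)
  show ?case
    using Cons.IH[of "\<lambda>ws. \<eta> (D v # ws)"] Cons.IH[of "\<lambda>ws. \<eta> ((\<i> *s D v) # ws)"]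
    by (simp add: assms)
qed simp

text \<open>Vanishing of the \<open>\<partial>/\<partial>zbar\<^sub>j\<close> leaves only the complex-linear part of the derivative.\<close>

lemma holomorphic_derivative_complex_linear:
  fixes F :: "complex^'n::finite \<Rightarrow> complex^'m::finite"
  assumes hol: "holomorphic_map_on S F" and x: "x \<in> S"
  shows "frechet_derivative F (at x) (\<i> *s v) = \<i> *s frechet_derivative F (at x) v"
proof (rule vec_eq_iff[THEN iffD2, rule_format])
  fix i
  have "F differentiable at x"
    using hol x smooth_on_differentiable by (auto simp: holomorphic_map_on_def)
  then have der: "((\<lambda>y. F y $ i) has_derivative (\<lambda>v. frechet_derivative F (at x) v $ i)) (at x)"
    unfolding frechet_derivative_works
    by (rule bounded_linear.has_derivative[OF bounded_linear_vec_nth])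
  then have diff: "(\<lambda>y. F y $ i) differentiable at x"
    unfolding differentiable_def by blast
  have "wirtinger True j (\<lambda>y. F y $ i) x = 0" for j
    using hol x by (simp add: wirtinger_def holomorphic_map_on_def)
  then have "frechet_derivative F (at x) v $ i = (\<Sum>j\<in>UNIV. v $ j * wirtinger False j (\<lambda>y. F y $ i) x)" for v
    using frechet_derivative_wirtinger[OF diff, of v] frechet_derivative_at[OF der]
    by (simp add: coframe_def fun_eq_iff)
  then show "frechet_derivative F (at x) (\<i> *s v) $ i = (\<i> *s frechet_derivative F (at x) v) $ i"
    by (simp add: sum_distrib_left mult.assoc)
qed


section \<open>Operators on global forms\<close>

definition scale_form :: "complex \<Rightarrow> ('a, 'n::finite) form \<Rightarrow> ('a, 'n) form" where
  "scale_form h u c x = type_scale h (u c x)"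

definition type_op :: "bool \<Rightarrow> ('a, 'n::finite) form \<Rightarrow> ('a, 'n) form" where
  "type_op bar u = (if bar then delbar_op u else del_op u)"

text \<open>Smoothness of the coefficients in each chart separately. It is kept apart from membership in
  \<open>forms\<close> because it passes from \<open>u\<close> to \<open>\<partial>u\<close> and \<open>\<partial>bar u\<close> by a purely local argument. The first
  alternative accounts for pairs outside the atlas, whose chart image may fail to be open.\<close>

definition smooth_coeffs :: "('a, 'n::finite) form \<Rightarrow> bool" where
  "smooth_coeffs u \<longleftrightarrow> (\<forall>c. u c = (\<lambda>x vs. 0) \<or>
     open (chart_image c) \<and> (\<forall>vs. smooth_on (chart_image c) (\<lambda>x. u c x vs)))"

lemma type_op_eq:
  "type_op bar u c x vs = (if x \<in> chart_image c then type_d bar (u c) x vs else 0)"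
  by (simp add: type_op_def type_d_def del_op_def delbar_op_def wirtinger_def coframe_def[abs_def])

lemma d_h_eq: "d_h h u c x vs = of_real h * type_op False u c x vs + type_op True u c x vs"
  by (simp add: d_h_def type_op_def)

lemma type_op_zero_chart: "u c = (\<lambda>x vs. 0) \<Longrightarrow> type_op bar u c = (\<lambda>x vs. 0)"
  by (simp add: fun_eq_iff type_op_eq type_d_def wedge1_def)

lemma smooth_coeffs_differentiable:
  assumes "smooth_coeffs u" "x \<in> chart_image c"
  shows "(\<lambda>y. u c y vs) differentiable at x"
proof (cases "u c = (\<lambda>x vs. 0)")
  case False
  with assms show ?thesis unfolding smooth_coeffs_def by (metis smooth_on_differentiable)
qed simp

lemma smooth_coeffs_type_op:
  assumes "smooth_coeffs u" shows "smooth_coeffs (type_op bar u)"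
  unfolding smooth_coeffs_def
proof
  fix c
  show "type_op bar u c = (\<lambda>x vs. 0) \<or>
     open (chart_image c) \<and> (\<forall>vs. smooth_on (chart_image c) (\<lambda>x. type_op bar u c x vs))"
  proof (cases "u c = (\<lambda>x vs. 0)")
    case False
    with assms have S: "open (chart_image c)" "\<And>vs. smooth_on (chart_image c) (\<lambda>x. u c x vs)"
      unfolding smooth_coeffs_def by blast+
    have "smooth_on (chart_image c) (\<lambda>x. type_op bar u c x vs)" for vs
      using smooth_on_type_d[where bar = bar and vs = vs, OF S]
      by (subst smooth_on_cong[OF S(1)]) (auto simp: type_op_eq)
    with S(1) show ?thesis by blast
  qed (simp add: type_op_zero_chart)
qed

lemma smooth_coeffs_scale_form:
  assumes "smooth_coeffs u" shows "smooth_coeffs (scale_form h u)"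
proof -
  have "scale_form h u c = (\<lambda>x vs. 0)" if "u c = (\<lambda>x vs. 0)" for c
    by (intro ext) (simp add: scale_form_def that)
  moreover have "smooth_on (chart_image c) (\<lambda>x. scale_form h u c x vs)"
    if "open (chart_image c)" "\<And>vs. smooth_on (chart_image c) (\<lambda>x. u c x vs)" for c vs
    unfolding scale_form_def by (rule smooth_on_type_scale) (fact that)+
  ultimately show ?thesis using assms unfolding smooth_coeffs_def by blast
qed

lemma smooth_coeffs_cmult:
  assumes "smooth_coeffs u" shows "smooth_coeffs (\<lambda>c x vs. a * u c x vs)"
proof -
  have "(\<lambda>x vs. a * u c x vs) = (\<lambda>x vs. 0)" if "u c = (\<lambda>x vs. 0)" for c
    by (intro ext) (simp add: that)
  moreover have "smooth_on (chart_image c) (\<lambda>x. a * u c x vs)"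
    if "open (chart_image c)" "\<And>vs. smooth_on (chart_image c) (\<lambda>x. u c x vs)" for c vs
    using smooth_on_lincomb[OF that(1) that(2) that(2), of a vs 0 vs] by simp
  ultimately show ?thesis using assms unfolding smooth_coeffs_def by blast
qed

lemma type_op_lincomb:
  assumes "smooth_coeffs u" "smooth_coeffs w"
  shows "type_op bar (\<lambda>c x vs. a * u c x vs + b * w c x vs) c x vs
       = a * type_op bar u c x vs + b * type_op bar w c x vs"
  using type_d_lincomb[OF smooth_coeffs_differentiable[OF assms(1)] smooth_coeffs_differentiable[OF assms(2)]]
  by (auto simp: type_op_eq)

lemma type_op_cmult:
  assumes "smooth_coeffs u"
  shows "type_op bar (\<lambda>c x vs. a * u c x vs) = (\<lambda>c x vs. a * type_op bar u c x vs)"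
  using type_op_lincomb[OF assms assms, of bar a 0] by (simp add: fun_eq_iff)

lemma type_op_anticommute:
  assumes "smooth_coeffs u"
  shows "type_op b (type_op b' u) c x vs = - type_op b' (type_op b u) c x vs"
proof (cases "u c = (\<lambda>x vs. 0) \<or> x \<notin> chart_image c")
  case True
  then show ?thesis by (auto simp: type_op_eq[of _ _ c x] type_op_zero_chart type_d_def wedge1_def)
next
  case False
  with assms have S: "open (chart_image c)" "\<And>vs. smooth_on (chart_image c) (\<lambda>x. u c x vs)"
    and x: "x \<in> chart_image c"
    unfolding smooth_coeffs_def by blast+
  have in_chart: "type_op b (type_op b' u) c x vs = type_d b (type_d b' (u c)) x vs" for b b'
    unfolding type_op_eq[of b] using x
    by (simp, intro type_d_cong[OF S(1) x])
      (auto simp: type_op_eq intro: smooth_on_differentiable[OF smooth_on_type_d[OF S] x])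
  show ?thesis unfolding in_chart by (rule type_d_anticommute[OF S(1) x S(2)])
qed

lemma scale_form_type_op:
  assumes "smooth_coeffs u"
  shows "scale_form h (type_op bar u) c x vs
       = (if bar then 1 else h) * type_op bar (scale_form h u) c x vs"
proof (cases "x \<in> chart_image c")
  case True
  then have "type_op bar u c x = type_d bar (u c) x" by (simp add: fun_eq_iff type_op_eq)
  then show ?thesis
    using type_scale_type_d[where h = h and bar = bar and vs = vs,
      OF smooth_coeffs_differentiable[OF assms True]] True
    by (simp add: scale_form_def[abs_def] type_op_eq)
next
  case False
  then have "type_op bar u c x = (\<lambda>vs. 0)" by (simp add: fun_eq_iff type_op_eq)
  with False show ?thesis by (simp add: scale_form_def type_op_eq)
qed

lemma scale_form_lincomb:
  "scale_form h (\<lambda>c x vs. a * u c x vs + b * w c x vs) c x vs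
     = a * scale_form h u c x vs + b * scale_form h w c x vs"
  by (simp add: scale_form_def type_scale_lincomb)

text \<open>This is \<open>\<theta>\<^sub>a d\<^sub>b = d\<^sub>a\<^sub>b \<theta>\<^sub>a\<close>: rescaling turns \<open>d = d\<^sub>1\<close> into \<open>d\<^sub>h\<close> for \<open>a = h\<close>, and \<open>d\<^sub>h\<close> back into \<open>d\<close> for
  \<open>a = 1/h\<close>.\<close>

lemma scale_form_d_h:
  assumes "smooth_coeffs u"
  shows "scale_form (of_real a) (d_h b u) = d_h (a * b) (scale_form (of_real a) u)"
proof (intro ext)
  fix c x vs
  have "d_h b u = (\<lambda>c x vs. of_real b * type_op False u c x vs + 1 * type_op True u c x vs)"
    by (simp add: fun_eq_iff d_h_eq)
  then show "scale_form (of_real a) (d_h b u) c x vs = d_h (a * b) (scale_form (of_real a) u) c x vs"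
    by (simp only: scale_form_lincomb scale_form_type_op[OF assms] d_h_eq) simp
qed

lemma ext_d_eq_d_h:
  assumes "smooth_coeffs u"
  shows "ext_d u = d_h 1 u"
proof (intro ext)
  fix c x vs
  show "ext_d u c x vs = d_h 1 u c x vs"
  proof (cases "x \<in> chart_image c")
    case True
    note diff = smooth_coeffs_differentiable[OF assms True]
    have "ext_d u c x vs = (\<Sum>i<length vs. \<Sum>j\<in>UNIV.
        (-1)^i * coframe False j (vs ! i) * wirtinger False j (\<lambda>y. u c y (delete_nth i vs)) x
      + (-1)^i * coframe True j (vs ! i) * wirtinger True j (\<lambda>y. u c y (delete_nth i vs)) x)"
      using True by (simp add: ext_d_def frechet_derivative_wirtinger[OF diff] sum_distrib_left algebra_simps)
    also have "\<dots> = (\<Sum>j\<in>UNIV. \<Sum>i<length vs.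
        (-1)^i * coframe False j (vs ! i) * wirtinger False j (\<lambda>y. u c y (delete_nth i vs)) x
      + (-1)^i * coframe True j (vs ! i) * wirtinger True j (\<lambda>y. u c y (delete_nth i vs)) x)"
      by (rule sum.swap)
    also have "\<dots> = d_h 1 u c x vs"
      using True by (simp add: d_h_eq type_op_eq type_d_def wedge1_def sum.distrib)
    finally show ?thesis .
  qed (simp add: ext_d_def d_h_eq type_op_eq)
qed

lemma scale_form_ext_d:
  assumes "smooth_coeffs u"
  shows "scale_form (of_real h) (ext_d u) = d_h h (scale_form (of_real h) u)"
  using scale_form_d_h[OF assms, of h 1] by (simp add: ext_d_eq_d_h[OF assms])

text \<open>The squares of \<open>\<partial>\<close> and \<open>\<partial>bar\<close> vanish, and the two mixed terms combine because \<open>\<partial>bar\<partial> = - \<partial>\<partial>bar\<close>.\<close>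

lemma d_h_d_h:
  assumes "smooth_coeffs u"
  shows "d_h a (d_h b u) c x vs = of_real (a - b) * del_op (delbar_op u) c x vs"
proof -
  let ?D = "type_op False" and ?E = "type_op True"
  note smooth = smooth_coeffs_type_op[OF assms]
  have d: "d_h b u = (\<lambda>c x vs. of_real b * ?D u c x vs + 1 * ?E u c x vs)"
    by (simp add: fun_eq_iff d_h_eq)
  have sq: "type_op t (type_op t u) c x vs = 0" for t
    using type_op_anticommute[OF assms, of t t c x vs] by simp
  have "d_h a (d_h b u) c x vs = of_real (a - b) * ?D (?E u) c x vs"
    unfolding d_h_eq[of a] d type_op_lincomb[OF smooth smooth] sq
      type_op_anticommute[OF assms, of True False]
    by (simp add: algebra_simps)
  then show ?thesis by (simp add: type_op_def)
qed


section \<open>Kernels and images under rescaling\<close>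

lemma complex_manifold_open_chart_image:
  assumes "complex_manifold X A" "c \<in> A" shows "open (chart_image c)"
  using assms by (auto simp: complex_manifold_def is_chart_def)

lemma formsD:
  assumes "u \<in> forms A k"
  shows "c \<notin> A \<or> x \<notin> chart_image c \<Longrightarrow> u c x vs = 0"
    and "c \<in> A \<Longrightarrow> x \<in> chart_image c \<Longrightarrow> alternating_form k (u c x)"
    and "c \<in> A \<Longrightarrow> smooth_on (chart_image c) (\<lambda>x. u c x vs)"
    and "c \<in> A \<Longrightarrow> c' \<in> A \<Longrightarrow> x \<in> overlap c c' \<Longrightarrow> u c x vs =
      u c' (transition c c' x) (map (frechet_derivative (transition c c') (at x)) vs)"
  using assms unfolding forms_def by blast+

lemma forms_smooth_coeffs:
  assumes "complex_manifold X A" "u \<in> forms A k"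
  shows "smooth_coeffs u"
  unfolding smooth_coeffs_def
proof
  fix c
  show "u c = (\<lambda>x vs. 0) \<or>
     open (chart_image c) \<and> (\<forall>vs. smooth_on (chart_image c) (\<lambda>x. u c x vs))"
  proof (cases "c \<in> A")
    case True
    then show ?thesis
      using complex_manifold_open_chart_image[OF assms(1)] formsD(3)[OF assms(2)] by blast
  next
    case False
    then have "u c = (\<lambda>x vs. 0)" by (intro ext formsD(1)[OF assms(2)]) blast
    then show ?thesis by blast
  qed
qed

lemma forms_cmult:
  assumes "complex_manifold X A" "u \<in> forms A k"
  shows "(\<lambda>c x vs. a * u c x vs) \<in> forms A k"
proof -
  have "smooth_on (chart_image c) (\<lambda>x. a * u c x vs)" if "c \<in> A" for c vs
    using smooth_on_lincomb[OF complex_manifold_open_chart_image[OF assms(1) that], of "\<lambda>x. u c x vs" "\<lambda>x. u c x vs" a 0] assms(2) that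
    by (simp add: forms_def)
  with assms(2) show ?thesis
    unfolding forms_def by (auto intro: alternating_form_cmult)
qed

text \<open>Compatibility with a change of charts holds because its derivative commutes with \<open>J\<close>.\<close>

lemma scale_form_forms:
  assumes X: "complex_manifold X A" and u: "u \<in> forms A k"
  shows "scale_form h u \<in> forms A k"
proof -
  note op = complex_manifold_open_chart_image[OF X]
  have "scale_form h u c x vs = 0" if "c \<notin> A \<or> x \<notin> chart_image c" for c x vs
    unfolding scale_form_def using that by (intro type_scale_eq_zero formsD(1)[OF u])
  moreover have "alternating_form k (scale_form h u c x)" if "c \<in> A" "x \<in> chart_image c" for c x
    unfolding scale_form_def by (intro alternating_form_type_scale formsD(2)[OF u] that)
  moreover have "smooth_on (chart_image c) (\<lambda>x. scale_form h u c x vs)" if "c \<in> A" for c vs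
    unfolding scale_form_def by (intro smooth_on_type_scale op formsD(3)[OF u] that)
  moreover have "scale_form h u c x vs =
      scale_form h u c' (transition c c' x) (map (frechet_derivative (transition c c') (at x)) vs)"
    if c: "c \<in> A" "c' \<in> A" "x \<in> overlap c c'" for c c' x vs
  proof -
    let ?D = "frechet_derivative (transition c c') (at x)"
    have "u c x = (\<lambda>vs. u c' (transition c c' x) (map ?D vs))"
      by (intro ext formsD(4)[OF u] c)
    moreover have "?D (\<i> *s v) = \<i> *s ?D v" for v
      using X c by (intro holomorphic_derivative_complex_linear) (auto simp: complex_manifold_def)
    ultimately show ?thesis by (simp add: scale_form_def type_scale_pullback)
  qed
  ultimately show ?thesis unfolding forms_def by blast
qed

lemma scale_form_inverse:
  assumes "u \<in> forms A k" "a * b = 1"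
  shows "scale_form a (scale_form b u) = u"
proof (intro ext)
  fix c x vs
  have "multilinear (u c x)"
  proof (cases "c \<in> A \<and> x \<in> chart_image c")
    case True
    then show ?thesis using formsD(2)[OF assms(1), of c x] by (simp add: alternating_form_iff)
  next
    case False
    then have "u c x = (\<lambda>vs. 0)" by (intro ext formsD(1)[OF assms(1)]) blast
    then show ?thesis by (simp add: multilinear_def linear_zero)
  qed
  then show "scale_form a (scale_form b u) c x vs = u c x vs"
    using assms(2) by (simp add: scale_form_def[abs_def] type_scale_mult type_scale_one)
qed

text \<open>For \<open>a \<noteq> b\<close> the operators \<open>d\<^sub>a\<close> and \<open>d\<^sub>b\<close> are independent combinations of \<open>\<partial>\<close> and \<open>\<partial>bar\<close>.\<close>

lemma ker_h_Int:
  assumes "a \<noteq> b"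
  shows "ker_h A a k \<inter> ker_h A b k = {u \<in> forms A k. \<forall>bar. type_op bar u = (\<lambda>c x vs. 0)}"
proof -
  have "d_h a u = (\<lambda>c x vs. 0) \<and> d_h b u = (\<lambda>c x vs. 0) \<longleftrightarrow> (\<forall>bar. type_op bar u = (\<lambda>c x vs. 0))"
    for u :: "('a, 'b) form"
  proof
    assume *: "d_h a u = (\<lambda>c x vs. 0) \<and> d_h b u = (\<lambda>c x vs. 0)"
    have "type_op False u c x vs = 0 \<and> type_op True u c x vs = 0" for c x vs
    proof -
      have eqs: "of_real a * type_op False u c x vs + type_op True u c x vs = 0"
        "of_real b * type_op False u c x vs + type_op True u c x vs = 0"
        using * by (metis d_h_eq)+
      have "(of_real a - of_real b) * type_op False u c x vs =
          (of_real a * type_op False u c x vs + type_op True u c x vs)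
        - (of_real b * type_op False u c x vs + type_op True u c x vs)"
        by (simp add: left_diff_distrib)
      also have "\<dots> = 0" by (simp only: eqs diff_self)
      finally have "type_op False u c x vs = 0" using assms by simp
      with eqs(1) show ?thesis by simp
    qed
    then show "\<forall>bar. type_op bar u = (\<lambda>c x vs. 0)"
      by (intro allI ext) (metis (full_types))
  next
    assume *: "\<forall>bar. type_op bar u = (\<lambda>c x vs. 0)"
    show "d_h a u = (\<lambda>c x vs. 0) \<and> d_h b u = (\<lambda>c x vs. 0)"
      by (intro conjI ext) (simp_all add: d_h_eq *)
  qed
  then show ?thesis unfolding ker_h_def by blast
qed

lemma scale_form_ker:
  assumes X: "complex_manifold X A" and "a \<noteq> b" "t \<noteq> 0"
    and u: "u \<in> ker_h A a k \<inter> ker_h A b k"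
  shows "scale_form t u \<in> ker_h A a k \<inter> ker_h A b k"
proof -
  have uf: "u \<in> forms A k" and ker: "type_op bar u = (\<lambda>c x vs. 0)" for bar
    using u by (auto simp: ker_h_Int[OF assms(2)])
  have "smooth_coeffs u"
    using forms_smooth_coeffs[OF X uf] .
  then have "type_op bar (scale_form t u) c x vs = 0" for bar c x vs
    using scale_form_type_op[of u t bar c x vs] \<open>t \<noteq> 0\<close>
    by (cases bar) (simp_all add: ker scale_form_def)
  then have "type_op bar (scale_form t u) = (\<lambda>c x vs. 0)" for bar
    by (intro ext)
  with scale_form_forms[OF X uf] show ?thesis by (simp add: ker_h_Int[OF assms(2)])
qed

text \<open>The nonzero factor \<open>a - b\<close> between \<open>d\<^sub>a d\<^sub>b\<close> and \<open>\<partial>\<partial>bar\<close> is absorbed into the form to which the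
  operators are applied.\<close>

lemma im_hh_eq_im_del_delbar:
  assumes X: "complex_manifold X A" and "a \<noteq> b"
  shows "im_hh A a b k = im_del_delbar A k"
proof -
  let ?r = "\<lambda>t w c x vs. complex_of_real t * w c x vs"
  have eq: "d_h a (d_h b (?r t w)) = del_op (delbar_op (?r ((a - b) * t) w))"
    if "w \<in> forms A (k - 2)" for w t
  proof -
    have w: "smooth_coeffs w" using forms_smooth_coeffs[OF X that] .
    have pull: "del_op (delbar_op (\<lambda>c x vs. s * w c x vs)) =
        (\<lambda>c x vs. s * del_op (delbar_op w) c x vs)" for s
      using type_op_cmult[OF w, of True] type_op_cmult[OF smooth_coeffs_type_op[OF w, of True], of False]
      by (simp add: type_op_def)
    show ?thesis
      by (intro ext) (unfold d_h_d_h[OF smooth_coeffs_cmult[OF w]] pull, simp)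
  qed
  have "d_h a (d_h b w) \<in> im_del_delbar A k" if w: "w \<in> forms A (k - 2)" for w
    using eq[OF w, of 1] forms_cmult[OF X w, of "of_real (a - b)"]
    by (auto simp: im_del_delbar_def)
  moreover have "del_op (delbar_op w) \<in> im_hh A a b k" if w: "w \<in> forms A (k - 2)" for w
  proof -
    have "d_h a (d_h b (?r (1 / (a - b)) w)) = del_op (delbar_op w)"
      using eq[OF w, of "1 / (a - b)"] \<open>a \<noteq> b\<close> by simp
    then show ?thesis
      using forms_cmult[OF X w, of "of_real (1 / (a - b))"] unfolding im_hh_def
      by (metis comp_apply image_eqI)
  qed
  ultimately show ?thesis by (auto simp: im_hh_def im_del_delbar_def)
qed

text \<open>Here \<open>\<theta>\<^sub>t \<partial>\<partial>bar w = \<partial>\<partial>bar (t \<theta>\<^sub>t w)\<close>.\<close>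

lemma scale_form_im_del_delbar:
  assumes X: "complex_manifold X A" and u: "u \<in> im_del_delbar A k"
  shows "scale_form t u \<in> im_del_delbar A k"
proof -
  obtain w where w: "w \<in> forms A (k - 2)" and uw: "u = del_op (delbar_op w)"
    using u by (auto simp: im_del_delbar_def)
  have sm: "smooth_coeffs w" using forms_smooth_coeffs[OF X w] .
  let ?w = "\<lambda>c x vs. t * scale_form t w c x vs"
  have inner: "scale_form t (type_op True w) = type_op True (scale_form t w)"
    by (intro ext) (simp add: scale_form_type_op[OF sm])
  have "u = type_op False (type_op True w)" by (simp add: uw type_op_def)
  then have "scale_form t u = (\<lambda>c x vs. t * type_op False (type_op True (scale_form t w)) c x vs)"
    by (intro ext) (simp add: scale_form_type_op[OF smooth_coeffs_type_op[OF sm]] inner)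
  also have "\<dots> = type_op False (type_op True ?w)"
    using smooth_coeffs_scale_form[OF sm]
    by (simp add: type_op_cmult smooth_coeffs_type_op)
  finally have "scale_form t u = del_op (delbar_op ?w)" by (simp add: type_op_def)
  moreover have "?w \<in> forms A (k - 2)"
    by (intro forms_cmult[OF X] scale_form_forms[OF X] w)
  ultimately show ?thesis unfolding im_del_delbar_def by (metis comp_apply image_eqI)
qed

lemma scale_form_im_d_iff:
  assumes X: "complex_manifold X A" and "h \<noteq> 0" and u: "u \<in> forms A k"
  shows "u \<in> im_d A k \<longleftrightarrow> scale_form (of_real h) u \<in> im_h A h k"
proof
  note smooth = forms_smooth_coeffs[OF X]
  assume "u \<in> im_d A k"
  then obtain v where v: "v \<in> forms A (k - 1)" "u = ext_d v" by (auto simp: im_d_def)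
  with scale_form_ext_d[OF smooth[OF v(1)], of h]
  show "scale_form (of_real h) u \<in> im_h A h k"
    by (auto simp: im_h_def intro!: imageI scale_form_forms[OF X])
next
  note smooth = forms_smooth_coeffs[OF X]
  assume "scale_form (of_real h) u \<in> im_h A h k"
  then obtain v where v: "v \<in> forms A (k - 1)" "scale_form (of_real h) u = d_h h v"
    by (auto simp: im_h_def)
  let ?v = "scale_form (of_real (1/h)) v"
  have v': "?v \<in> forms A (k - 1)" by (rule scale_form_forms[OF X v(1)])
  have "u = scale_form (of_real (1/h)) (scale_form (of_real h) u)"
    using \<open>h \<noteq> 0\<close> by (intro scale_form_inverse[OF u, symmetric]) simp
  also have "\<dots> = ext_d ?v"
    unfolding v(2) scale_form_d_h[OF smooth[OF v(1)]] ext_d_eq_d_h[OF smooth[OF v']]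
    using \<open>h \<noteq> 0\<close> by simp
  finally show "u \<in> im_d A k" using v' by (simp add: im_d_def)
qed

lemma scale_form_im_del_delbar_iff:
  assumes X: "complex_manifold X A" and "t \<noteq> 0" and u: "u \<in> forms A k"
  shows "u \<in> im_del_delbar A k \<longleftrightarrow> scale_form t u \<in> im_del_delbar A k"
  using scale_form_im_del_delbar[OF X, of u k t]
    scale_form_im_del_delbar[OF X, of "scale_form t u" k "1/t"]
    scale_form_inverse[OF u, of "1/t" t] \<open>t \<noteq> 0\<close> by auto


section \<open>Exactness for \<open>d\<close> and for \<open>\<partial>\<partial>bar\<close>\<close>

theorem corollary4p19:
  fixes h :: real and X :: "'a topology" and A :: "('a, 'n::finite) chart set"
  assumes "h \<noteq> 0" and "compact_complex_manifold X A"
  shows "(\<forall>k\<in>{0..2 * int CARD('n)}.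
            (\<forall>u \<in> ker_h A h k \<inter> ker_h A (- (1/h)) k.
               (u \<in> im_h A h k \<longleftrightarrow> u \<in> im_h A (- (1/h)) k) \<and>
               (u \<in> im_h A (- (1/h)) k \<longleftrightarrow> u \<in> im_hh A h (- (1/h)) k))
            \<longrightarrow> (\<forall>u \<in> ker_h A h k \<inter> ker_h A (- (1/h)) k.
                   u \<in> im_d A k \<longleftrightarrow> u \<in> im_hh A h (- (1/h)) k))
       \<and> (\<forall>k\<in>{0..2 * int CARD('n)}. im_hh A h (- (1/h)) k = im_del_delbar A k)
       \<and> ((\<forall>k\<in>{0..2 * int CARD('n)}. \<forall>u \<in> ker_h A h k \<inter> ker_h A (- (1/h)) k.
               (u \<in> im_h A h k \<longleftrightarrow> u \<in> im_h A (- (1/h)) k) \<and>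
               (u \<in> im_h A (- (1/h)) k \<longleftrightarrow> u \<in> im_hh A h (- (1/h)) k))
            \<longrightarrow> h_del_delbar_manifold h X A)"
proof -
  have X: "complex_manifold X A"
    using assms(2) by (simp add: compact_complex_manifold_def)
  let ?h' = "- (1/h)"
  have neq: "h \<noteq> ?h'"
  proof
    assume "h = ?h'"
    then have "h * h = - 1" using assms(1) by (simp add: field_simps)
    then show False using zero_le_square[of h] by linarith
  qed
  have dd: "im_hh A h ?h' k = im_del_delbar A k" for k
    by (rule im_hh_eq_im_del_delbar[OF X neq])
  have d: "u \<in> im_d A k \<longleftrightarrow> u \<in> im_hh A h ?h' k"
    if hyp: "\<forall>u \<in> ker_h A h k \<inter> ker_h A ?h' k.
        (u \<in> im_h A h k \<longleftrightarrow> u \<in> im_h A ?h' k) \<and> (u \<in> im_h A ?h' k \<longleftrightarrow> u \<in> im_hh A h ?h' k)"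
      and u: "u \<in> ker_h A h k \<inter> ker_h A ?h' k" for k u
  proof -
    let ?u = "scale_form (of_real h) u"
    have uf: "u \<in> forms A k" using u by (simp add: ker_h_def)
    have "u \<in> im_d A k \<longleftrightarrow> ?u \<in> im_h A h k"
      by (rule scale_form_im_d_iff[OF X assms(1) uf])
    also have "\<dots> \<longleftrightarrow> ?u \<in> im_hh A h ?h' k"
      using hyp scale_form_ker[OF X neq _ u, of "of_real h"] assms(1) by simp
    also have "\<dots> \<longleftrightarrow> u \<in> im_hh A h ?h' k"
      unfolding dd using scale_form_im_del_delbar_iff[OF X _ uf, of "of_real h"] assms(1) by simp
    finally show ?thesis .
  qed
  have manifold: "h_del_delbar_manifold h X A"
    if hyp: "\<forall>k\<in>{0..2 * int CARD('n)}. \<forall>u \<in> ker_h A h k \<inter> ker_h A ?h' k.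
        (u \<in> im_h A h k \<longleftrightarrow> u \<in> im_h A ?h' k) \<and> (u \<in> im_h A ?h' k \<longleftrightarrow> u \<in> im_hh A h ?h' k)"
    unfolding h_del_delbar_manifold_def
  proof (intro conjI ballI)
    fix k u assume k: "k \<in> {0..2 * int CARD('n)}" and u: "u \<in> ker_h A h k \<inter> ker_h A ?h' k"
    note eq = bspec[OF bspec[OF hyp k] u]
    show "u \<in> im_h A h k \<longleftrightarrow> u \<in> im_h A ?h' k" using eq by blast
    show "u \<in> im_d A k \<longleftrightarrow> u \<in> im_hh A h ?h' k" by (rule d[OF bspec[OF hyp k] u])
    with eq show "u \<in> im_h A ?h' k \<longleftrightarrow> u \<in> im_d A k" by blast
  qed (use assms(2) dd in auto)
  show ?thesis using d dd manifold by blast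
qed

end
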